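(* For every partition $\lambda$ of $n$ and every $j = 0,1,\dots,n-1$, the Eulerian quasisymmetric function $Q_{\lambda,j}$ is a symmetric function.
   Context: For $n\ge1$, $\mathfrak S_n$ is the symmetric group on $[n]=\{1,\dots,n\}$, and $\sigma\in\mathfrak S_n$ is written $\sigma_1\cdots\sigma_n$ with $\sigma_i=\sigma(i)$. $\mathrm{EXC}(\sigma)=\{i\in[n-1]:\sigma_i>i\}$, $\mathrm{exc}(\sigma)=|\mathrm{EXC}(\sigma)|$, and $\lambda(\sigma)$ is the cycle type of $\sigma$. Totally order the alphabet $[n]\cup\{\bar1,\dots,\bar n\}$ by $\bar1<\cdots<\bar n<1<\cdots<n$. Let $\bar\sigma$ be the word obtained from $\sigma_1\cdots\sigma_n$ by replacing $\sigma_i$ with $\overline{\sigma_i}$ for each $i\in\mathrm{EXC}(\sigma)$, and let $\mathrm{DEX}(\sigma)$ be the set of $i\in[n-1]$ such that the $i$th letter of $\bar\sigma$ is larger than the $(i+1)$st. For $S\subseteq[n-1]$, $F_{S,n}(\mathbf x)=\sum x_{i_1}\cdots x_{i_n}$, summed over all $i_1\ge\cdots\ge i_n\ge1$ with $i_j>i_{j+1}$ whenever $j\in S$. For $\lambda\vdash n$, $Q_{\lambda,j}=\sum F_{\mathrm{DEX}(\sigma),n}$, summed over $\sigma\in\mathfrak S_n$ with $\mathrm{exc}(\sigma)=j$ and $\lambda(\sigma)=\lambda$. *)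

theory Defs
  imports "HOL-Library.Multiset" "HOL-Combinatorics.Permutations" "HOL-Combinatorics.Orbits"
begin

(* A monomial x_{i_1} ... x_{i_d} in the variables x_1, x_2, ... is the multiset
   {#i_1, ..., i_d#} of its indices, and a formal power series with integer
   coefficients is its coefficient function. *)

type_synonym monomial = "nat multiset"
type_synonym power_series = "monomial \<Rightarrow> int"

(* Symmetric functions are the power series in x_1, x_2, ... of bounded degree that are
   invariant under all permutations of the variables.  The first condition excludes
   the variable x_0, which the type of monomials allows.  Note that w is an arbitrary
   bijection of the positive integers, not necessarily of finite support. *)

definition symmetric_function :: "power_series \<Rightarrow> bool" where
  "symmetric_function f \<longleftrightarrow>
     (\<forall>m. f m \<noteq> 0 \<longrightarrow> set_mset m \<subseteq> {1..}) \<and>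
     (\<exists>d. \<forall>m. f m \<noteq> 0 \<longrightarrow> size m \<le> d) \<and>
     (\<forall>w. w permutes {1..} \<longrightarrow> (\<forall>m. f (image_mset w m) = f m))"

(* A partition is the multiset of its parts. *)

definition is_partition :: "nat multiset \<Rightarrow> nat \<Rightarrow> bool" where
  "is_partition lam n \<longleftrightarrow> 0 \<notin># lam \<and> sum_mset lam = n"

(* The cycles of s on [n], fixed points included, correspond to its orbits on [n]. *)

definition cycle_type :: "nat \<Rightarrow> (nat \<Rightarrow> nat) \<Rightarrow> nat multiset" where
  "cycle_type n s = image_mset card (mset_set (orbit s ` {1..n}))"

definition EXC :: "nat \<Rightarrow> (nat \<Rightarrow> nat) \<Rightarrow> nat set" where
  "EXC n s = {i \<in> {1..n-1}. s i > i}"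

definition exc :: "nat \<Rightarrow> (nat \<Rightarrow> nat) \<Rightarrow> nat" where
  "exc n s = card (EXC n s)"

datatype letter = Barred nat | Plain nat

instantiation letter :: linorder
begin

fun less_letter :: "letter \<Rightarrow> letter \<Rightarrow> bool" where
  "Barred a < Barred b \<longleftrightarrow> a < b"
| "Barred a < Plain b \<longleftrightarrow> True"
| "Plain a < Barred b \<longleftrightarrow> False"
| "Plain a < Plain b \<longleftrightarrow> a < b"

definition less_eq_letter :: "letter \<Rightarrow> letter \<Rightarrow> bool" where
  "less_eq_letter a b \<longleftrightarrow> a < b \<or> a = b"

instance
proof
  fix x y z :: letter
  show "x < y \<longleftrightarrow> x \<le> y \<and> \<not> y \<le> x"
    by (cases x; cases y) (auto simp: less_eq_letter_def)
  show "x \<le> x"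
    by (simp add: less_eq_letter_def)
  show "x \<le> y \<Longrightarrow> y \<le> z \<Longrightarrow> x \<le> z"
    by (cases x; cases y; cases z) (auto simp: less_eq_letter_def)
  show "x \<le> y \<Longrightarrow> y \<le> x \<Longrightarrow> x = y"
    by (cases x; cases y) (auto simp: less_eq_letter_def)
  show "x \<le> y \<or> y \<le> x"
    by (cases x; cases y) (auto simp: less_eq_letter_def)
qed

end

definition barred_word :: "nat \<Rightarrow> (nat \<Rightarrow> nat) \<Rightarrow> nat \<Rightarrow> letter" where
  "barred_word n s i = (if i \<in> EXC n s then Barred (s i) else Plain (s i))"

definition DEX :: "nat \<Rightarrow> (nat \<Rightarrow> nat) \<Rightarrow> nat set" where
  "DEX n s = {i \<in> {1..n-1}. barred_word n s i > barred_word n s (i + 1)}"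

(* The index sequence i_1, ..., i_n is a list, with i_j at list position j - 1. *)

definition index_seqs :: "nat set \<Rightarrow> nat \<Rightarrow> nat list set" where
  "index_seqs S n = {l. length l = n \<and> (\<forall>i \<in> set l. i \<ge> 1) \<and>
     (\<forall>j \<in> {1..n-1}. l ! (j - 1) \<ge> l ! j) \<and>
     (\<forall>j \<in> {1..n-1}. j \<in> S \<longrightarrow> l ! (j - 1) > l ! j)}"

(* The sum of the monomials of all index sequences: its coefficient at m counts the
   sequences with monomial m, a finite set because a multiset has finitely many orderings. *)

definition fundamental_qsym :: "nat set \<Rightarrow> nat \<Rightarrow> power_series" where
  "fundamental_qsym S n m = int (card {l \<in> index_seqs S n. mset l = m})"

definition eulerian_qsym :: "nat \<Rightarrow> nat multiset \<Rightarrow> nat \<Rightarrow> power_series" where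
  "eulerian_qsym n lam j m =
     (\<Sum>s | s permutes {1..n} \<and> exc n s = j \<and> cycle_type n s = lam.
        fundamental_qsym (DEX n s) n m)"

end

theory Submission
  imports Defs
begin

text \<open>
The coefficient of a monomial \<open>m\<close> in \<open>eulerian_qsym n lam j\<close> counts permutations, and the idea is
to count other objects instead, for which the exchange of two variables is visible.

Let \<open>m\<close> have \<open>n\<close> entries, all positive, and write them in decreasing order as \<open>v 1, ..., v n\<close>.
The coefficient is the number of permutations \<open>\<sigma>\<close> with \<open>j\<close> excedances and cycle type \<open>lam\<close> such
that \<open>v\<close> decreases strictly at every element of \<open>DEX \<sigma>\<close>. Replace each element \<open>i\<close> in the cycles of
\<open>\<sigma>\<close> by the value \<open>v i\<close>, barred if \<open>i\<close> is an excedance. As \<open>v\<close> decreases, a barred value is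
followed by a weakly smaller one and an unbarred value by a weakly larger one. This gives a multiset
of circular words, an ornament, with \<open>j\<close> bars, contents \<open>m\<close> and word lengths \<open>lam\<close>.

In the manner of Gessel and Reutenauer, \<open>\<sigma>\<close> can be recovered: attach to each \<open>i\<close> the infinite word
read from \<open>i\<close> on. The condition on \<open>DEX \<sigma>\<close> forces these words to be in lexicographic order, and
equal words to be permuted by \<open>\<sigma>\<close> in an order-preserving way. Sorting the words of an arbitrary
ornament and letting \<open>\<sigma>\<close> send a word to its shift therefore inverts the construction
(\<open>labelled_permutation_unique\<close>, \<open>ornament_from_permutation\<close>). So the coefficient is the number of
ornaments with contents \<open>m\<close> (\<open>eulerian_qsym_eq_card_ornaments\<close>).

It remains to exchange \<open>k\<close> and \<open>k + 1\<close> in the contents. In each circular word, take the maximal runs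
of the values \<open>k\<close> and \<open>k + 1\<close>, reverse each of them and exchange the two values; every bar moves
with the step that it describes. Reversal and exchange together preserve weak descents and weak
ascents, and steps into or out of a run do not distinguish \<open>k\<close> from \<open>k + 1\<close>. This is an involution
that keeps lengths, periods and the number of bars (\<open>card_ornaments_swap\<close>). Adjacent transpositions
generate all permutations of the finitely many values that occur in a monomial
(\<open>injection_invariance\<close>).
\<close>

section \<open>Periodic words\<close>

text \<open>A word is a bi-infinite sequence of letters, each of them a value together with a flag that says
whether the letter is barred. Bi-infinite words replace circular ones: a circular word of length
\<open>p\<close> with no smaller period corresponds to the \<open>p\<close> shifts of a periodic bi-infinite word.\<close>

type_synonym word = "int \<Rightarrow> nat \<times> bool"

definition shift :: "int \<Rightarrow> word \<Rightarrow> word" where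
  "shift d u = (\<lambda>t. u (t + d))"

lemma shift_apply: "shift d u t = u (t + d)"
  by (simp add: shift_def)

lemma shift_shift [simp]: "shift c (shift d u) = shift (c + d) u"
  by (simp add: shift_def add.assoc)

lemma shift_0 [simp]: "shift 0 u = u"
  by (simp add: shift_def)

lemma shift_eq_iff [simp]: "shift d u = shift d w \<longleftrightarrow> u = w"
  by (metis shift_shift shift_0 add.left_inverse)

definition periodic :: "word \<Rightarrow> bool" where
  "periodic u \<longleftrightarrow> (\<exists>p>0. shift p u = u)"

lemma shift_multiple:
  assumes "shift p u = u"
  shows "shift (i * p) u = u"
proof -
  have nat: "shift (int j * p) u = u" for j
  proof (induction j)
    case (Suc j)
    have "shift (int (Suc j) * p) u = shift (int j * p) (shift p u)"
      by (simp add: algebra_simps)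
    then show ?case
      using Suc assms by simp
  qed simp
  show ?thesis
  proof (cases "i \<ge> 0")
    case True
    then show ?thesis
      using nat[of "nat i"] by simp
  next
    case False
    then have "shift (- i * p) u = u"
      using nat[of "nat (- i)"] by simp
    then have "shift (i * p) u = shift (i * p) (shift (- i * p) u)"
      by simp
    then show ?thesis
      by simp
  qed
qed

lemma periodic_shift [simp]: "periodic (shift d u) \<longleftrightarrow> periodic u"
proof -
  have "shift p (shift d u) = shift d u \<longleftrightarrow> shift p u = u" for p
    by (metis shift_shift shift_eq_iff add.commute)
  then show ?thesis
    by (simp add: periodic_def)
qed

lemma periodic_periodE:
  assumes "periodic u"
  obtains p where "p > 0" "\<And>t i. u (t + i * p) = u t"
proof -
  from assms obtain p where p: "p > 0" "shift p u = u"
    by (auto simp: periodic_def)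
  have "u (t + i * p) = u t" for t i
    using shift_multiple[OF p(2), of i] by (metis shift_apply)
  with p(1) show thesis
    by (rule that)
qed

section \<open>Exchanging two adjacent values\<close>

text \<open>Fix the two adjacent values \<open>k\<close> and \<open>k + 1\<close>. The positions of a word fall into classes, namely
the maximal runs of consecutive positions with values in \<open>{k, k + 1}\<close> and, for all other
positions, singletons.\<close>

definition linked :: "nat \<Rightarrow> word \<Rightarrow> int \<Rightarrow> int \<Rightarrow> bool" where
  "linked k u s t \<longleftrightarrow>
     s = t \<or> (\<forall>r. min s t \<le> r \<and> r \<le> max s t \<longrightarrow> fst (u r) \<in> {k, Suc k})"

definition run :: "nat \<Rightarrow> word \<Rightarrow> int \<Rightarrow> int set" where
  "run k u t = {s. linked k u s t}"

definition two_valued :: "nat \<Rightarrow> word \<Rightarrow> bool" where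
  "two_valued k u \<longleftrightarrow> (\<forall>t. fst (u t) \<in> {k, Suc k})"

text \<open>The bar of a letter constrains the step from its position to the next one, so in a reversal bars
move with the steps: \<open>mirror\<close> reflects the positions of each run, and \<open>mirror_step\<close> reflects the
steps within each run, a step being named by its left end. In a word with values in \<open>{k, k + 1}\<close>
only, the run is the whole line and has no centre; it is reflected about position 0.\<close>

definition mirror :: "nat \<Rightarrow> word \<Rightarrow> int \<Rightarrow> int" where
  "mirror k u t = (if two_valued k u then - t else Min (run k u t) + Max (run k u t) - t)"

definition mirror_step :: "nat \<Rightarrow> word \<Rightarrow> int \<Rightarrow> int" where
  "mirror_step k u t = (if linked k u t (t + 1) then mirror k u (t + 1) else t)"

text \<open>Reversing a run and exchanging its two values keeps every weak descent a weak descent and every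
weak ascent a weak ascent, so each bar can be carried along with its step.\<close>

definition swap_word :: "nat \<Rightarrow> word \<Rightarrow> word" where
  "swap_word k u = (\<lambda>t. (transpose k (Suc k) (fst (u (mirror k u t))), snd (u (mirror_step k u t))))"

lemma linked_refl [simp]: "linked k u t t"
  by (simp add: linked_def)

lemma linked_sym: "linked k u s t \<Longrightarrow> linked k u t s"
  by (auto simp: linked_def min.commute max.commute)

lemma linked_trans:
  assumes "linked k u r s" "linked k u s t"
  shows "linked k u r t"
proof (cases "r = s \<or> s = t")
  case True
  then show ?thesis using assms by auto
next
  case False
  then have 1: "\<And>x. min r s \<le> x \<Longrightarrow> x \<le> max r s \<Longrightarrow> fst (u x) \<in> {k, Suc k}"
    and 2: "\<And>x. min s t \<le> x \<Longrightarrow> x \<le> max s t \<Longrightarrow> fst (u x) \<in> {k, Suc k}"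
    using assms by (auto simp: linked_def)
  have "fst (u x) \<in> {k, Suc k}" if "min r t \<le> x" "x \<le> max r t" for x
    using 1[of x] 2[of x] that by (cases "x \<le> s"; linarith)
  then show ?thesis by (auto simp: linked_def)
qed

lemma run_eq: "linked k u s t \<Longrightarrow> run k u s = run k u t"
  unfolding run_def using linked_sym linked_trans by blast

lemma linked_between: "linked k u r t \<Longrightarrow> r \<le> s \<Longrightarrow> s \<le> t \<Longrightarrow> linked k u s t"
  by (cases "s = t"; auto simp: linked_def)

lemma linked_values:
  "linked k u s t \<Longrightarrow> fst (u s) \<in> {k, Suc k} \<longleftrightarrow> fst (u t) \<in> {k, Suc k}"
  unfolding linked_def by (metis max.cobounded1 max.cobounded2 min.cobounded1 min.cobounded2)

lemma linked_outside:
  "linked k u s t \<Longrightarrow> fst (u t) \<notin> {k, Suc k} \<Longrightarrow> s = t"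
  unfolding linked_def by (metis max.cobounded2 min.cobounded2)

lemma self_in_run [simp]: "t \<in> run k u t"
  by (simp add: run_def)

lemma linked_two_valued: "two_valued k u \<Longrightarrow> linked k u s t"
  by (simp add: linked_def two_valued_def)

text \<open>A letter with a value outside \<open>{k, k + 1}\<close> recurs arbitrarily far on both sides and thus bounds
every run.\<close>

lemma finite_run:
  assumes "periodic u" "\<not> two_valued k u"
  shows "finite (run k u t)"
proof -
  obtain p where p: "p > 0" "\<And>t i. u (t + i * p) = u t"
    using periodic_periodE[OF assms(1)] by blast
  obtain r where r: "fst (u r) \<notin> {k, Suc k}"
    using assms(2) by (auto simp: two_valued_def)
  \<comment> \<open>After \<open>i\<close> periods, the position \<open>r\<close> has been carried past \<open>t\<close> in either direction.\<close>
  define i where "i = \<bar>t - r\<bar> + 1"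
  have ip: "i * p \<ge> i"
    using p(1) by (auto simp: i_def mult_le_cancel_left1)
  have lo: "r - i * p < t" and hi: "t < r + i * p"
    using ip unfolding i_def by linarith+
  have out: "fst (u (r - i * p)) \<notin> {k, Suc k}" "fst (u (r + i * p)) \<notin> {k, Suc k}"
    using p(2)[of r i] p(2)[of r "- i"] r by simp_all
  have "run k u t \<subseteq> {r - i * p..r + i * p}"
  proof
    fix s assume s: "s \<in> run k u t"
    show "s \<in> {r - i * p..r + i * p}"
    proof (rule ccontr)
      assume "s \<notin> {r - i * p..r + i * p}"
      then consider "s < r - i * p" | "r + i * p < s" by force
      then show False
      proof cases
        case 1
        then show False
          using s lo out(1) by (auto simp: run_def linked_def)
      next
        case 2
        then show False
          using s hi out(2) by (auto simp: run_def linked_def)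
      qed
    qed
  qed
  then show ?thesis
    by (rule finite_subset) simp
qed

lemma mirror_linked:
  assumes "periodic u"
  shows "linked k u (mirror k u t) t"
proof (cases "two_valued k u")
  case True
  then show ?thesis by (rule linked_two_valued)
next
  case False
  let ?S = "run k u t"
  have fin: "finite ?S" and ne: "?S \<noteq> {}"
    using finite_run[OF assms False] self_in_run by blast+
  have t: "t \<in> ?S" by (simp add: run_def)
  have bounds: "Min ?S \<le> t" "t \<le> Max ?S"
    using fin t by auto
  have mem: "linked k u (Min ?S) t" "linked k u (Max ?S) t"
    using Min_in[OF fin ne] Max_in[OF fin ne] by (auto simp: run_def)
  have "linked k u (Min ?S) (Max ?S)"
    using mem linked_sym linked_trans by blast
  then have "linked k u (Min ?S + Max ?S - t) (Max ?S)"
    by (rule linked_between) (use bounds in auto)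
  then show ?thesis
    using False mem linked_trans by (auto simp: mirror_def)
qed

text \<open>The centre of the reflection is shared by all positions of a run. That makes \<open>mirror\<close> an
involution, and makes it carry steps of a run to steps of the run.\<close>

lemma mirror_sum:
  assumes "linked k u s t"
  shows "mirror k u s + s = mirror k u t + t"
  using run_eq[OF assms] by (simp add: mirror_def)

lemma mirror_mirror:
  assumes "periodic u"
  shows "mirror k u (mirror k u t) = t"
  using mirror_sum[OF mirror_linked[OF assms, of k t]] by simp

lemma mirror_step_linked:
  assumes "linked k u t (t + 1)"
  shows "mirror_step k u t + 1 = mirror k u t"
  using mirror_sum[OF assms] assms by (simp add: mirror_step_def)

lemma mirror_step_preserves_linked:
  assumes "periodic u" "linked k u t (t + 1)"
  shows "linked k u (mirror_step k u t) (mirror_step k u t + 1)"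
proof -
  have "linked k u (mirror k u (t + 1)) (t + 1)" "linked k u (mirror k u t) t"
    using assms(1) mirror_linked by auto
  then have "linked k u (mirror k u (t + 1)) (mirror k u t)"
    using assms(2) linked_sym linked_trans by meson
  then show ?thesis
    using assms(2) mirror_step_linked[OF assms(2)] by (simp add: mirror_step_def)
qed

lemma mirror_step_mirror_step:
  assumes "periodic u"
  shows "mirror_step k u (mirror_step k u t) = t"
proof (cases "linked k u t (t + 1)")
  case True
  then have "mirror_step k u (mirror_step k u t) = mirror k u (mirror_step k u t + 1)"
    using mirror_step_preserves_linked[OF assms True] by (simp add: mirror_step_def)
  then show ?thesis
    using mirror_step_linked[OF True] mirror_mirror[OF assms] by simp
qed (simp add: mirror_step_def)

lemma transpose_two_values:
  "transpose k (Suc k) x \<in> {k, Suc k} \<longleftrightarrow> x \<in> {k, Suc k}"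
  by (auto simp: transpose_def)

text \<open>The swapped word has its runs at the same positions, hence also the same reflections, which is why
swapping twice gives back the word.\<close>

lemma swap_word_values:
  assumes "periodic u"
  shows "fst (swap_word k u t) \<in> {k, Suc k} \<longleftrightarrow> fst (u t) \<in> {k, Suc k}"
  using linked_values[OF mirror_linked[OF assms]] transpose_two_values
  unfolding swap_word_def fst_conv by blast

lemma
  assumes "periodic u"
  shows linked_swap_word: "linked k (swap_word k u) = linked k u"
    and mirror_swap_word: "mirror k (swap_word k u) = mirror k u"
    and mirror_step_swap_word: "mirror_step k (swap_word k u) = mirror_step k u"
    and two_valued_swap_word: "two_valued k (swap_word k u) = two_valued k u"
proof -
  show l: "linked k (swap_word k u) = linked k u"
    unfolding linked_def swap_word_values[OF assms] ..
  show tv: "two_valued k (swap_word k u) = two_valued k u"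
    unfolding two_valued_def swap_word_values[OF assms] ..
  show m: "mirror k (swap_word k u) = mirror k u"
    unfolding mirror_def run_def l tv ..
  show "mirror_step k (swap_word k u) = mirror_step k u"
    unfolding mirror_step_def l m ..
qed

lemma swap_word_swap_word:
  assumes "periodic u"
  shows "swap_word k (swap_word k u) = u"
proof
  fix t
  have "swap_word k (swap_word k u) t =
    (transpose k (Suc k) (fst (swap_word k u (mirror k u t))),
     snd (swap_word k u (mirror_step k u t)))"
    by (subst (1) swap_word_def)
       (simp add: mirror_swap_word mirror_step_swap_word assms)
  also have "\<dots> = u t"
    by (simp add: swap_word_def mirror_mirror mirror_step_mirror_step assms)
  finally show "swap_word k (swap_word k u) t = u t" .
qed

lemma linked_shift: "linked k (shift d u) s t = linked k u (s + d) (t + d)"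
proof -
  have "(\<forall>r. min s t \<le> r \<and> r \<le> max s t \<longrightarrow> fst (u (r + d)) \<in> {k, Suc k}) \<longleftrightarrow>
    (\<forall>r. min (s + d) (t + d) \<le> r \<and> r \<le> max (s + d) (t + d) \<longrightarrow> fst (u r) \<in> {k, Suc k})"
    (is "?A \<longleftrightarrow> ?B")
  proof
    assume A: ?A
    show ?B
    proof (intro allI impI)
      fix r assume "min (s + d) (t + d) \<le> r \<and> r \<le> max (s + d) (t + d)"
      then have "min s t \<le> r - d \<and> r - d \<le> max s t" by linarith
      with A have "fst (u (r - d + d)) \<in> {k, Suc k}" by blast
      then show "fst (u r) \<in> {k, Suc k}" by simp
    qed
  next
    assume B: ?B
    show ?A
    proof (intro allI impI)
      fix r assume "min s t \<le> r \<and> r \<le> max s t"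
      then have "min (s + d) (t + d) \<le> r + d \<and> r + d \<le> max (s + d) (t + d)" by linarith
      with B show "fst (u (r + d)) \<in> {k, Suc k}" by blast
    qed
  qed
  then show ?thesis
    unfolding linked_def shift_apply by simp
qed

lemma two_valued_shift [simp]: "two_valued k (shift d u) = two_valued k u"
  unfolding two_valued_def shift_apply by (metis diff_add_cancel)

lemma run_shift: "run k u (t + d) = (\<lambda>s. s + d) ` run k (shift d u) t"
proof -
  have "s \<in> (\<lambda>s. s + d) ` run k (shift d u) t" if "s \<in> run k u (t + d)" for s
    using that by (intro image_eqI[of _ _ "s - d"]) (auto simp: run_def linked_shift)
  then show ?thesis
    by (auto simp: run_def linked_shift)
qed

lemma mirror_shift:
  assumes "periodic u" "\<not> two_valued k u"
  shows "mirror k (shift d u) t = mirror k u (t + d) - d"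
proof -
  let ?R = "run k (shift d u) t"
  have fin: "finite ?R" and ne: "?R \<noteq> {}"
    using finite_run[of "shift d u" k t] assms self_in_run by (simp, blast)
  have mono: "mono (\<lambda>s::int. s + d)" by (simp add: mono_def)
  have "Min (run k u (t + d)) = Min ?R + d" "Max (run k u (t + d)) = Max ?R + d"
    unfolding run_shift
    using mono_Min_commute[OF mono fin ne] mono_Max_commute[OF mono fin ne] by simp_all
  then show ?thesis
    using assms by (simp add: mirror_def)
qed

lemma mirror_step_shift:
  assumes "periodic u" "\<not> two_valued k u"
  shows "mirror_step k (shift d u) t = mirror_step k u (t + d) - d"
proof -
  have e: "t + 1 + d = t + d + 1" by simp
  show ?thesis
    unfolding mirror_step_def linked_shift mirror_shift[OF assms] e by simp
qed

lemma mirror_two_valued: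
  assumes "two_valued k u"
  shows "mirror k u t = - t" "mirror_step k u t = - t - 1"
  using assms linked_two_valued[OF assms] by (auto simp: mirror_def mirror_step_def)

text \<open>Reflection about position 0 turns a shift into the opposite shift, whereas reflecting bounded runs
about their own centres is compatible with shifts.\<close>

lemma swap_word_shift:
  assumes "periodic u"
  shows "swap_word k (shift d u) = shift (if two_valued k u then - d else d) (swap_word k u)"
proof (cases "two_valued k u")
  case True
  then show ?thesis
    by (auto simp: fun_eq_iff swap_word_def mirror_two_valued shift_apply algebra_simps)
next
  case False
  then show ?thesis
    using assms
    by (auto simp: fun_eq_iff swap_word_def mirror_shift mirror_step_shift shift_apply)
qed

lemma periodic_swap_word:
  assumes "periodic u"
  shows "periodic (swap_word k u)"
proof -
  obtain p where p: "p > 0" "shift p u = u" using assms by (auto simp: periodic_def)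
  have "shift (if two_valued k u then - p else p) (swap_word k u) = swap_word k u"
    using swap_word_shift[OF assms, of k p] p(2) by simp
  then have "shift p (swap_word k u) = swap_word k u"
    using shift_multiple[of "- p" "swap_word k u" "-1"] by (auto split: if_splits)
  with p(1) show ?thesis by (auto simp: periodic_def)
qed

lemma shift_swap_word_fixed_iff:
  assumes "periodic u"
  shows "shift p (swap_word k u) = swap_word k u \<longleftrightarrow> shift p u = u"
proof -
  have *: "shift p (swap_word k u) = swap_word k u" if "periodic u" "shift p u = u" for u
    using swap_word_shift[OF that(1), of k p] that(2)
      shift_multiple[of "- p" "swap_word k u" "-1"] by (auto split: if_splits)
  show ?thesis
    using *[of u] *[of "swap_word k u"] periodic_swap_word[OF assms] assms
    by (auto simp: swap_word_swap_word)
qed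

section \<open>Ornaments\<close>

text \<open>In a periodic word whose letters are all barred, the values only decrease and hence are constant.
The second clause excludes such words: they would have to come from a cycle of which every element
is an excedance.\<close>

definition admissible :: "word \<Rightarrow> bool" where
  "admissible u \<longleftrightarrow>
     (\<forall>t. if snd (u t) then fst (u (t + 1)) \<le> fst (u t) else fst (u t) \<le> fst (u (t + 1))) \<and>
     (\<exists>t. \<not> snd (u t))"

lemma admissible_swap_word:
  assumes "periodic u" "admissible u"
  shows "admissible (swap_word k u)"
proof -
  have step: "if snd (u t) then fst (u (t + 1)) \<le> fst (u t) else fst (u t) \<le> fst (u (t + 1))" for t
    using assms(2) by (auto simp: admissible_def)
  obtain t0 where t0: "\<not> snd (u t0)"
    using assms(2) by (auto simp: admissible_def)
  have "\<not> snd (swap_word k u (mirror_step k u t0))"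
    using t0 by (simp add: swap_word_def mirror_step_mirror_step[OF assms(1)])
  moreover have "if snd (swap_word k u t) then fst (swap_word k u (t + 1)) \<le> fst (swap_word k u t)
    else fst (swap_word k u t) \<le> fst (swap_word k u (t + 1))" for t
  \<comment> \<open>A step inside a run comes from the reflected step. A step with an end outside
    \<open>{k, k + 1}\<close> keeps its bar, and comparing a value with a value outside \<open>{k, k + 1}\<close> does
    not distinguish \<open>k\<close> from \<open>k + 1\<close>.\<close>
  proof (cases "linked k u t (t + 1)")
    case True
    define s where "s = mirror_step k u t"
    have s1: "mirror k u t = s + 1" and s0: "mirror k u (t + 1) = s"
      using mirror_step_linked[OF True] True by (auto simp: s_def mirror_step_def)
    have mem: "fst (u t) \<in> {k, Suc k}" "fst (u (t + 1)) \<in> {k, Suc k}"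
      using True by (auto simp: linked_def)
    have in_run: "fst (u s) \<in> {k, Suc k}" "fst (u (s + 1)) \<in> {k, Suc k}"
      using mem linked_values[OF mirror_linked[OF assms(1), of k t]]
        linked_values[OF mirror_linked[OF assms(1), of k "t + 1"]] by (simp_all add: s0 s1)
    have "fst (swap_word k u t) = transpose k (Suc k) (fst (u (s + 1)))"
      "fst (swap_word k u (t + 1)) = transpose k (Suc k) (fst (u s))"
      "snd (swap_word k u t) = snd (u s)"
      by (simp_all add: swap_word_def s0 s1 flip: s_def)
    then show ?thesis
      using step[of s] in_run by (auto simp: transpose_def)
  next
    case False
    then have "\<not> (fst (u t) \<in> {k, Suc k} \<and> fst (u (t + 1)) \<in> {k, Suc k})"
      by (auto simp: linked_def) (smt (verit))+
    moreover have "fst (swap_word k u r) = fst (u r)" if "fst (u r) \<notin> {k, Suc k}" for r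
      using linked_outside[OF mirror_linked[OF assms(1)] that] that
      by (simp add: swap_word_def transpose_def)
    moreover have "fst (swap_word k u r) \<in> {k, Suc k}" if "fst (u r) \<in> {k, Suc k}" for r
      using swap_word_values[OF assms(1)] that by blast
    moreover have "snd (swap_word k u t) = snd (u t)"
      using False by (simp add: swap_word_def mirror_step_def)
    ultimately show ?thesis
      using step[of t] by (smt (verit) insert_iff empty_iff le_Suc_eq le_antisym nat_le_linear not_less_eq_eq)
  qed
  ultimately show ?thesis
    unfolding admissible_def by blast
qed

text \<open>Needed for maps that shift each word by an amount depending on the word: on a shift-invariant
multiset it suffices that such a map is injective.\<close>

lemma image_mset_self:
  assumes inj: "inj_on g (set_mset M)" and count: "\<And>u. u \<in># M \<Longrightarrow> count M (g u) = count M u"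
  shows "image_mset g M = M"
proof -
  have "g ` set_mset M \<subseteq> set_mset M"
    using count by (metis image_subsetI count_greater_zero_iff)
  then have surj: "g ` set_mset M = set_mset M"
    using inj by (simp add: endo_inj_surj)
  show ?thesis
  proof (rule multiset_eqI)
    fix w
    show "count (image_mset g M) w = count M w"
    proof (cases "w \<in># M")
      case True
      then obtain u where u: "u \<in># M" "w = g u" using surj by blast
      have "count (image_mset g M) (g u) = sum (count M) {u' \<in> set_mset M. g u' = g u}"
        by (simp add: count_image_mset vimage_def Int_def conj_commute)
      also have "{u' \<in> set_mset M. g u' = g u} = {u}"
        using inj u by (auto dest: inj_onD)
      finally show ?thesis
        using u count by simp
    next
      case False
      then have "w \<notin> g ` set_mset M" using surj by simp
      then show ?thesis
        using False by (metis count_eq_zero_iff set_image_mset)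
    qed
  qed
qed

lemma shift_invariant_count:
  assumes "image_mset (shift 1) M = M"
  shows "count M (shift d u) = count M u"
proof -
  have one: "count M (shift 1 u) = count M u" for u
  proof -
    have "count (image_mset (shift 1) M) (shift 1 u) = count M u"
      by (induction M) auto
    then show ?thesis by (simp add: assms)
  qed
  have nat: "count M (shift (int n) u) = count M u" for n u
  proof (induction n arbitrary: u)
    case (Suc n)
    then show ?case
      using one[of "shift (int n) u"] by (simp add: add.commute)
  qed simp
  show ?thesis
  proof (cases "d \<ge> 0")
    case True
    then show ?thesis using nat[of "nat d" u] by simp
  next
    case False
    then show ?thesis using nat[of "nat (- d)" "shift d u"] by simp
  qed
qed

text \<open>All shifts of a word of the multiset lie in a finite set, so two of them coincide.\<close>

lemma shift_invariant_periodic: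
  assumes "image_mset (shift 1) M = M" "u \<in># M"
  shows "periodic u"
proof -
  have "(\<lambda>d. shift (int d) u) ` UNIV \<subseteq> set_mset M"
    using assms shift_invariant_count[OF assms(1)] by (metis image_subsetI count_greater_zero_iff)
  then have "finite (range (\<lambda>d. shift (int d) u))"
    by (rule finite_subset) simp
  then have "\<not> inj (\<lambda>d. shift (int d) u)"
    using finite_imageD infinite_UNIV_nat by blast
  then obtain d e :: nat where de: "d < e" "shift (int d) u = shift (int e) u"
    unfolding inj_def by (metis linorder_neqE_nat)
  then have "shift (int e - int d) u = u"
    by (metis (no_types, opaque_lifting) diff_add_cancel add.commute shift_shift shift_eq_iff)
  with de(1) show ?thesis
    unfolding periodic_def by (metis diff_gt_0_iff_gt of_nat_less_iff)
qed

definition period :: "word \<Rightarrow> nat" where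
  "period u = (LEAST p. 0 < p \<and> shift (int p) u = u)"

text \<open>A shift-invariant multiset of words stands for a multiset of primitive circular words: a circular
word of length \<open>p\<close> with multiplicity \<open>c\<close> contributes each of its \<open>p\<close> shifts \<open>c\<close> times. Reading off
the letters at position 0 of all words therefore reads every letter of every circular word once,
and \<open>p * count lam p\<close> words of period \<open>p\<close> are \<open>count lam p\<close> circular words of length \<open>p\<close>.\<close>

definition ornaments :: "nat multiset \<Rightarrow> nat \<Rightarrow> nat multiset \<Rightarrow> word multiset set" where
  "ornaments lam j m = {M. image_mset (shift 1) M = M \<and> (\<forall>u\<in>#M. admissible u) \<and>
     image_mset (\<lambda>u. fst (u 0)) M = m \<and> size {#u \<in># M. snd (u 0)#} = j \<and>
     (\<forall>p. size {#u \<in># M. period u = p#} = p * count lam p)}"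

text \<open>The letters at position 0 of the swapped words are found in the original words at positions that
depend on the word. Shifting each word so that the wanted position moves to 0 permutes a
shift-invariant multiset, so the values in total are those of the original words with \<open>k\<close> and
\<open>k + 1\<close> exchanged, and the number of bars is unchanged. The same device gives shift-invariance,
because swapping reverses the direction of some shifts.\<close>

lemma swap_ornament:
  assumes "M \<in> ornaments lam j m"
  shows "image_mset (swap_word k) M \<in> ornaments lam j (image_mset (transpose k (Suc k)) m)"
proof -
  have inv: "image_mset (shift 1) M = M" and adm: "\<And>u. u \<in># M \<Longrightarrow> admissible u"
    and heads: "image_mset (\<lambda>u. fst (u 0)) M = m" and bars: "size {#u \<in># M. snd (u 0)#} = j"
    and per: "\<And>p. size {#u \<in># M. period u = p#} = p * count lam p"
    using assms by (auto simp: ornaments_def)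
  have cyc: "periodic u" if "u \<in># M" for u
    using shift_invariant_periodic[OF inv that] .
  have rotate: "image_mset (\<lambda>u. shift (f u) u) M = M" if "inj_on (\<lambda>u. shift (f u) u) (set_mset M)" for f
    using that by (rule image_mset_self) (rule shift_invariant_count[OF inv])

  let ?d = "\<lambda>u. if two_valued k u then - 1 else 1 :: int"
  have "inj_on (\<lambda>u. shift (?d u) u) (set_mset M)"
    by (rule inj_onI) (metis shift_eq_iff two_valued_shift)
  then have rot: "image_mset (\<lambda>u. shift (?d u) u) M = M"
    by (rule rotate)
  have "image_mset (shift 1) (image_mset (swap_word k) M) =
      image_mset (\<lambda>u. swap_word k (shift (?d u) u)) M"
    unfolding image_mset.compositionality o_def
    by (rule image_mset_cong) (auto simp: swap_word_shift cyc)
  also have "\<dots> = image_mset (swap_word k) (image_mset (\<lambda>u. shift (?d u) u) M)"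
    by (simp add: image_mset.compositionality o_def)
  finally have inv': "image_mset (shift 1) (image_mset (swap_word k) M) = image_mset (swap_word k) M"
    unfolding rot .

  have "inj_on (\<lambda>u. shift (mirror k u 0) u) (set_mset M)"
  proof (rule inj_on_inverseI)
    fix u assume u: "u \<in># M"
    show "(\<lambda>u. shift (mirror k u 0) u) (shift (mirror k u 0) u) = u"
      using mirror_shift[OF cyc[OF u], of k "mirror k u 0" 0] mirror_mirror[OF cyc[OF u], of k 0]
      by (cases "two_valued k u") (auto simp: mirror_two_valued)
  qed
  then have "image_mset (\<lambda>u. shift (mirror k u 0) u) M = M"
    by (rule rotate)
  then have "m = image_mset (\<lambda>u. fst (u 0)) (image_mset (\<lambda>u. shift (mirror k u 0) u) M)"
    using heads by simp
  then have heads': "image_mset (\<lambda>u. fst (u 0)) (image_mset (swap_word k) M) =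
      image_mset (transpose k (Suc k)) m"
    by (simp add: image_mset.compositionality o_def swap_word_def shift_apply)

  have "inj_on (\<lambda>u. shift (mirror_step k u 0) u) (set_mset M)"
  proof (rule inj_onI)
    fix u w assume u: "u \<in># M" and w: "w \<in># M"
      and eq: "shift (mirror_step k u 0) u = shift (mirror_step k w 0) w"
    have same: "two_valued k u = two_valued k w"
      using eq by (metis two_valued_shift)
    have undo: "shift (mirror_step k (shift (mirror_step k u 0) u) 0) (shift (mirror_step k u 0) u) = u"
      if "u \<in># M" "\<not> two_valued k u" for u
      using mirror_step_shift[OF cyc[OF that(1)] that(2), of "mirror_step k u 0" 0]
        mirror_step_mirror_step[OF cyc[OF that(1)], of k 0] by simp
    show "u = w"
    proof (cases "two_valued k u")
      case True
      then show ?thesis using eq same by (simp add: mirror_two_valued)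
    next
      case False
      then show ?thesis using undo[OF u] undo[OF w] eq same by simp
    qed
  qed
  then have "image_mset (\<lambda>u. shift (mirror_step k u 0) u) M = M"
    by (rule rotate)
  then have "j = size {#u \<in># image_mset (\<lambda>u. shift (mirror_step k u 0) u) M. snd (u 0)#}"
    using bars by simp
  then have bars': "size {#u \<in># image_mset (swap_word k) M. snd (u 0)#} = j"
    by (simp add: filter_mset_image_mset swap_word_def shift_apply)

  have "period (swap_word k u) = period u" if "u \<in># M" for u
    unfolding period_def shift_swap_word_fixed_iff[OF cyc[OF that]] ..
  then have "size {#u \<in># image_mset (swap_word k) M. period u = p#} = p * count lam p" for p
    using per[of p] by (simp add: filter_mset_image_mset cong: filter_mset_cong)
  with inv' heads' bars' show ?thesis
    using adm cyc admissible_swap_word by (auto simp: ornaments_def)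
qed

lemma swap_ornament_inverse:
  assumes "M \<in> ornaments lam j m"
  shows "image_mset (swap_word k) (image_mset (swap_word k) M) = M"
proof -
  have "image_mset (shift 1) M = M" using assms by (simp add: ornaments_def)
  then have "swap_word k (swap_word k u) = u" if "u \<in># M" for u
    using that shift_invariant_periodic swap_word_swap_word by blast
  then show ?thesis
    by (simp add: image_mset.compositionality o_def cong: image_mset_cong)
qed

lemma card_ornaments_swap:
  "card (ornaments lam j (image_mset (transpose k (Suc k)) m)) = card (ornaments lam j m)"
proof (rule bij_betw_same_card[symmetric])
  let ?m = "image_mset (transpose k (Suc k)) m"
  have m: "image_mset (transpose k (Suc k)) ?m = m"
    by (simp add: image_mset.compositionality o_def)
  show "bij_betw (image_mset (swap_word k)) (ornaments lam j m) (ornaments lam j ?m)"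
    by (rule bij_betw_byWitness[where f' = "image_mset (swap_word k)"])
       (use swap_ornament[of _ lam j ?m k] swap_ornament[of _ lam j m k] swap_ornament_inverse m
         in \<open>auto\<close>)
qed

section \<open>Sorting periodic words\<close>

text \<open>Larger values come first, since the index sequences are decreasing; among equal values barred
letters come first, since the barred alphabet is the smaller one.\<close>

definition letter_before :: "nat \<times> bool \<Rightarrow> nat \<times> bool \<Rightarrow> bool" where
  "letter_before x y \<longleftrightarrow> fst y < fst x \<or> fst x = fst y \<and> snd x \<and> \<not> snd y"

lemma letter_before_irrefl [simp]: "\<not> letter_before x x"
  by (simp add: letter_before_def)

lemma letter_before_trans: "letter_before x y \<Longrightarrow> letter_before y z \<Longrightarrow> letter_before x z"
  by (auto simp: letter_before_def)

lemma letter_before_total: "x = y \<or> letter_before x y \<or> letter_before y x"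
  by (cases x; cases y) (auto simp: letter_before_def)

text \<open>Only the future of a word, its letters at positions from 0 on, is compared. This suffices because a
periodic word is determined by its future.\<close>

definition precedes :: "word \<Rightarrow> word \<Rightarrow> bool" where
  "precedes u w \<longleftrightarrow>
     (\<exists>t::nat. (\<forall>s<t. u (int s) = w (int s)) \<and> letter_before (u (int t)) (w (int t)))"

lemma precedes_irrefl [simp]: "\<not> precedes u u"
  by (simp add: precedes_def)

lemma precedes_trans:
  assumes "precedes u v" "precedes v w"
  shows "precedes u w"
proof -
  obtain s where s: "\<And>r. r < s \<Longrightarrow> u (int r) = v (int r)" "letter_before (u (int s)) (v (int s))"
    using assms(1) by (auto simp: precedes_def)
  obtain t where t: "\<And>r. r < t \<Longrightarrow> v (int r) = w (int r)" "letter_before (v (int t)) (w (int t))"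
    using assms(2) by (auto simp: precedes_def)
  have "letter_before (u (int (min s t))) (w (int (min s t)))"
  proof (cases s t rule: linorder_cases)
    case less
    then show ?thesis using s(2) t(1)[of s] by simp
  next
    case equal
    then show ?thesis using s(2) t(2) letter_before_trans by simp
  next
    case greater
    then show ?thesis using s(1)[of t] t(2) by (simp add: min_def)
  qed
  then show ?thesis
    unfolding precedes_def using s(1) t(1) by (intro exI[of _ "min s t"]) auto
qed

lemma precedes_asym: "precedes u w \<Longrightarrow> \<not> precedes w u"
  using precedes_trans precedes_irrefl by blast

lemma periodic_eqI:
  assumes "periodic u" "periodic w" "\<And>t::nat. u (int t) = w (int t)"
  shows "u = w"
proof
  fix t
  obtain p where p: "p > 0" "\<And>t i. u (t + i * p) = u t"
    using periodic_periodE[OF assms(1)] by blast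
  obtain q where q: "q > 0" "\<And>t i. w (t + i * q) = w t"
    using periodic_periodE[OF assms(2)] by blast
  define s where "s = t + \<bar>t\<bar> * (p * q)"
  have "p * q \<ge> 1" using p(1) q(1) by (simp add: zero_less_mult_iff int_one_le_iff_zero_less)
  then have "\<bar>t\<bar> * 1 \<le> \<bar>t\<bar> * (p * q)" by (intro mult_left_mono) auto
  then have "0 \<le> s" by (simp add: s_def)
  moreover have "u s = u t" "w s = w t"
    using p(2)[of t "\<bar>t\<bar> * q"] q(2)[of t "\<bar>t\<bar> * p"] by (simp_all add: s_def algebra_simps)
  ultimately show "u t = w t"
    using assms(3)[of "nat s"] by simp
qed

lemma first_difference:
  assumes "periodic u" "periodic w" "u \<noteq> w"
  obtains t :: nat where "\<And>s. s < t \<Longrightarrow> u (int s) = w (int s)" "u (int t) \<noteq> w (int t)"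
proof -
  have "\<exists>t::nat. u (int t) \<noteq> w (int t)"
    using periodic_eqI assms by blast
  then show thesis
    using that[of "LEAST t. u (int t) \<noteq> w (int t)"] LeastI_ex not_less_Least by (metis (mono_tags, lifting))
qed

lemma precedes_total:
  assumes "periodic u" "periodic w"
  shows "u = w \<or> precedes u w \<or> precedes w u"
proof (cases "u = w")
  case False
  then obtain t where t: "\<And>s. s < t \<Longrightarrow> u (int s) = w (int s)" "u (int t) \<noteq> w (int t)"
    using first_difference[OF assms] by metis
  then consider "letter_before (u (int t)) (w (int t))" | "letter_before (w (int t)) (u (int t))"
    using letter_before_total by blast
  then show ?thesis
  proof cases
    case 1
    then have "precedes u w" using t(1) by (auto simp: precedes_def)
    then show ?thesis by simp
  next
    case 2
    then have "precedes w u" unfolding precedes_def using t(1) by (intro exI[of _ t]) auto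
    then show ?thesis by simp
  qed
qed simp

lemma precedes_head:
  assumes "precedes u w"
  shows "u 0 = w 0 \<or> letter_before (u 0) (w 0)"
proof -
  obtain t where t: "\<And>s. s < t \<Longrightarrow> u (int s) = w (int s)" "letter_before (u (int t)) (w (int t))"
    using assms by (auto simp: precedes_def)
  show ?thesis
    using t(1)[of 0] t(2) by (cases t) auto
qed

lemma precedes_tail:
  assumes "precedes u w" "u 0 = w 0"
  shows "precedes (shift 1 u) (shift 1 w)"
proof -
  obtain t where t: "\<And>s. s < t \<Longrightarrow> u (int s) = w (int s)" "letter_before (u (int t)) (w (int t))"
    using assms(1) by (auto simp: precedes_def)
  have "t \<noteq> 0" using t(2) assms(2) by (metis letter_before_irrefl of_nat_0)
  then obtain r where "t = Suc r" by (cases t) auto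
  then have "(\<forall>s<r. shift 1 u (int s) = shift 1 w (int s)) \<and>
      letter_before (shift 1 u (int r)) (shift 1 w (int r))"
    using t(2) t(1)[of "Suc s" for s] by (simp add: shift_apply add.commute)
  then show ?thesis
    unfolding precedes_def by blast
qed

text \<open>The bar of the first letter is visible in the order. In \<open>u\<close> and \<open>shift 1 u\<close> the first difference
is at the end of the initial run of letters equal to the first one, and there admissibility decides
which word is smaller. Such a run of barred letters must end, by the clause in \<open>admissible\<close> that
excludes words with bars only.\<close>

lemma precedes_next_iff:
  assumes "periodic u" "admissible u"
  shows "precedes u (shift 1 u) \<longleftrightarrow> snd (u 0)"
proof
  assume "precedes u (shift 1 u)"
  then obtain t :: nat where t: "\<And>s. s < t \<Longrightarrow> u (int s) = u (int s + 1)"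
      "letter_before (u (int t)) (u (int t + 1))"
    by (auto simp: precedes_def shift_apply)
  have "u (int s) = u 0" if "s \<le> t" for s
    using that
  proof (induction s)
    case (Suc s)
    then show ?case using t(1)[of s] by (simp add: add.commute)
  qed simp
  then have t0: "u (int t) = u 0" by simp
  have "if snd (u (int t)) then fst (u (int t + 1)) \<le> fst (u (int t))
      else fst (u (int t)) \<le> fst (u (int t + 1))"
    using assms(2) by (auto simp: admissible_def)
  with t(2) show "snd (u 0)"
    unfolding t0 letter_before_def by (auto split: if_splits)
next
  assume barred: "snd (u 0)"
  obtain t1 where t1: "\<not> snd (u t1)"
    using assms(2) by (auto simp: admissible_def)
  have "u \<noteq> (\<lambda>_. u 0)"
    using barred t1 by metis
  moreover have "periodic (\<lambda>_. u 0)"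
    unfolding periodic_def by (intro exI[of _ 1]) (simp add: shift_def)
  ultimately obtain t where t: "\<And>s. s < t \<Longrightarrow> u (int s) = u 0" "u (int t) \<noteq> u 0"
    using first_difference[OF assms(1)] by metis
  then obtain r where r: "t = Suc r" by (cases t) auto
  have "if snd (u (int r)) then fst (u (int r + 1)) \<le> fst (u (int r))
      else fst (u (int r)) \<le> fst (u (int r + 1))"
    using assms(2) by (auto simp: admissible_def)
  then have "letter_before (u (int r)) (u (int r + 1))"
    using barred t(2) t(1)[of r] unfolding r letter_before_def
    by (auto simp: add.commute prod_eq_iff)
  moreover have "u (int s) = u (int s + 1)" if "s < r" for s
    using t(1)[of s] t(1)[of "Suc s"] that unfolding r by (simp add: add.commute)
  ultimately show "precedes u (shift 1 u)"
    unfolding precedes_def shift_apply by blast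
qed

text \<open>In any sorted arrangement of \<open>M\<close>, the copies of \<open>u\<close> occupy exactly the positions from \<open>rank M u + 1\<close>
to \<open>rank M u + count M u\<close>; this is what makes the arrangement unique.\<close>

definition rank :: "word multiset \<Rightarrow> word \<Rightarrow> nat" where
  "rank M u = size {#w \<in># M. precedes w u#}"

lemma rank_plus_count: "rank M u + count M u = size {#w \<in># M. precedes w u \<or> w = u#}"
  unfolding rank_def by (induction M) auto

lemma rank_less:
  assumes "precedes u w"
  shows "rank M u + count M u \<le> rank M w"
  unfolding rank_plus_count unfolding rank_def
  by (rule size_mset_mono, rule filter_mset_mono_strong) (use assms precedes_trans in auto)

lemma rank_count_le_size: "rank M u + count M u \<le> size M"
  unfolding rank_plus_count by (simp add: size_mset_mono)

definition sorted_enumeration :: "nat \<Rightarrow> (nat \<Rightarrow> word) \<Rightarrow> word multiset \<Rightarrow> bool" where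
  "sorted_enumeration n U M \<longleftrightarrow> image_mset U (mset_set {1..n}) = M \<and> (\<forall>u\<in>#M. periodic u) \<and>
     (\<forall>i i'. 1 \<le> i \<longrightarrow> i < i' \<longrightarrow> i' \<le> n \<longrightarrow> U i = U i' \<or> precedes (U i) (U i'))"

lemma size_filter_image:
  assumes "finite A"
  shows "size {#u \<in># image_mset U (mset_set A). P u#} = card {i \<in> A. P (U i)}"
  using assms by (simp add: filter_mset_image_mset)

lemma rank_bounds:
  assumes "sorted_enumeration n U M" "i \<in> {1..n}"
  shows "rank M (U i) < i" "i \<le> rank M (U i) + count M (U i)"
proof -
  have M: "M = image_mset U (mset_set {1..n})"
    and sorted: "\<And>i i'. 1 \<le> i \<Longrightarrow> i < i' \<Longrightarrow> i' \<le> n \<Longrightarrow> U i = U i' \<or> precedes (U i) (U i')"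
    using assms(1) by (auto simp: sorted_enumeration_def)
  have "{i' \<in> {1..n}. precedes (U i') (U i)} \<subseteq> {1..<i}"
  proof
    fix i' assume i': "i' \<in> {i' \<in> {1..n}. precedes (U i') (U i)}"
    then have "i' \<noteq> i" "\<not> precedes (U i) (U i')" "U i \<noteq> U i'"
      using precedes_asym by auto
    then have "\<not> i < i'" using sorted[of i i'] i' assms(2) by auto
    then show "i' \<in> {1..<i}" using i' \<open>i' \<noteq> i\<close> by simp
  qed
  then have "card {i' \<in> {1..n}. precedes (U i') (U i)} \<le> card {1..<i}"
    by (rule card_mono[rotated]) simp
  then show "rank M (U i) < i"
    unfolding rank_def M by (subst size_filter_image) (use assms(2) in auto)
  have "{1..i} \<subseteq> {i' \<in> {1..n}. precedes (U i') (U i) \<or> U i' = U i}"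
  proof
    fix i' assume "i' \<in> {1..i}"
    then show "i' \<in> {i' \<in> {1..n}. precedes (U i') (U i) \<or> U i' = U i}"
      using sorted[of i' i] assms(2) by (cases "i' = i") auto
  qed
  then have "card {1..i} \<le> card {i' \<in> {1..n}. precedes (U i') (U i) \<or> U i' = U i}"
    by (rule card_mono[rotated]) simp
  then show "i \<le> rank M (U i) + count M (U i)"
    unfolding rank_plus_count M by (subst size_filter_image) auto
qed

lemma enumeration_mem:
  assumes "sorted_enumeration n U M" "i \<in> {1..n}"
  shows "U i \<in># M" "periodic (U i)"
proof -
  show "U i \<in># M" using assms by (auto simp: sorted_enumeration_def)
  then show "periodic (U i)" using assms by (auto simp: sorted_enumeration_def)
qed

lemma enumeration_eqI:
  assumes "sorted_enumeration n U M" "i \<in> {1..n}" "periodic u"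
    and "rank M u < i" "i \<le> rank M u + count M u"
  shows "U i = u"
  using precedes_total[OF enumeration_mem(2)[OF assms(1,2)] assms(3)] rank_less[of "U i" u M]
    rank_less[of u "U i" M] rank_bounds[OF assms(1,2)] assms(4,5) by fastforce

lemma enumeration_unique:
  assumes "sorted_enumeration n U M" "sorted_enumeration n U' M" "i \<in> {1..n}"
  shows "U i = U' i"
  using enumeration_eqI[OF assms(1,3) enumeration_mem(2)[OF assms(2,3)]] rank_bounds[OF assms(2,3)]
  by simp

lemma minimal_word:
  assumes "M \<noteq> {#}"
  obtains u where "u \<in># M" "\<And>w. w \<in># M \<Longrightarrow> \<not> precedes w u"
proof -
  obtain u where u: "u \<in># M" "\<And>w. w \<in># M \<Longrightarrow> rank M u \<le> rank M w"
    using ex_has_least_nat[of "\<lambda>u. u \<in># M" _ "rank M"] assms by (metis multiset_nonemptyE)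
  have "\<not> precedes w u" if "w \<in># M" for w
  proof
    assume "precedes w u"
    then have "rank M w + count M w \<le> rank M u" by (rule rank_less)
    moreover have "count M w > 0" using that by simp
    ultimately show False using u(2)[OF that] by simp
  qed
  with u(1) show thesis by (rule that)
qed

lemma sorted_list_exists:
  assumes "\<forall>u\<in>#M. periodic u"
  shows "\<exists>xs. mset xs = M \<and> sorted_wrt (\<lambda>u w. u = w \<or> precedes u w) xs"
  using assms
proof (induction "size M" arbitrary: M)
  case (Suc n)
  obtain u where u: "u \<in># M" "\<And>w. w \<in># M \<Longrightarrow> \<not> precedes w u"
    using minimal_word[of M] Suc.hyps(2) by (metis size_empty nat.distinct(1))
  define N where "N = M - {#u#}"
  have M: "M = add_mset u N" using u(1) by (simp add: N_def)
  obtain xs where xs: "mset xs = N" "sorted_wrt (\<lambda>u w. u = w \<or> precedes u w) xs"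
    using Suc.hyps(1)[of N] Suc.hyps(2) Suc.prems by (auto simp: M)
  have "u = w \<or> precedes u w" if "w \<in> set xs" for w
  proof -
    have "w \<in># M" using that xs(1) by (auto simp: M)
    then show ?thesis using u precedes_total[of u w] Suc.prems by blast
  qed
  with xs show ?case by (intro exI[of _ "u # xs"]) (auto simp: M)
qed auto

lemma mset_set_image_upt: "image_mset f (mset_set {1..n}) = mset (map f [1..<Suc n])"
proof -
  have "mset [1..<Suc n] = mset_set {1..<Suc n}" by (rule mset_upt)
  then show ?thesis by (simp add: atLeastLessThanSuc_atLeastAtMost del: upt_Suc)
qed

lemma enumeration_exists:
  assumes "\<forall>u\<in>#M. periodic u"
  shows "\<exists>U. sorted_enumeration (size M) U M"
proof -
  obtain xs where xs: "mset xs = M" "sorted_wrt (\<lambda>u w. u = w \<or> precedes u w) xs"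
    using sorted_list_exists[OF assms] by blast
  have len: "size M = length xs" using xs(1) by auto
  have "map (\<lambda>i. xs ! (i - 1)) [1..<Suc (length xs)] = xs"
    by (rule nth_equalityI) (auto simp del: upt_Suc)
  then have "image_mset (\<lambda>i. xs ! (i - 1)) (mset_set {1..size M}) = M"
    unfolding mset_set_image_upt len using xs(1) by simp
  moreover have "xs ! (i - 1) = xs ! (i' - 1) \<or> precedes (xs ! (i - 1)) (xs ! (i' - 1))"
    if "1 \<le> i" "i < i'" "i' \<le> length xs" for i i'
    using sorted_wrt_nth_less[OF xs(2), of "i - 1" "i' - 1"] that by auto
  ultimately show ?thesis
    unfolding sorted_enumeration_def using assms len by (intro exI[of _ "\<lambda>i. xs ! (i - 1)"]) auto
qed

section \<open>From permutations to ornaments\<close>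

definition iterate :: "(nat \<Rightarrow> nat) \<Rightarrow> int \<Rightarrow> nat \<Rightarrow> nat" where
  "iterate s t i = (if t \<ge> 0 then (s ^^ nat t) i else (inv s ^^ nat (- t)) i)"

text \<open>The word read along the cycle of \<open>i\<close> when every element \<open>x\<close> carries the value \<open>v x\<close> and a bar if it
is an excedance.\<close>

definition itinerary :: "(nat \<Rightarrow> nat) \<Rightarrow> (nat \<Rightarrow> nat) \<Rightarrow> nat \<Rightarrow> word" where
  "itinerary v s i = (\<lambda>t. (v (iterate s t i), iterate s t i < s (iterate s t i)))"

lemma iterate_of_nat [simp]: "iterate s (int k) i = (s ^^ k) i"
  by (simp add: iterate_def)

lemma iterate_step:
  assumes "bij s"
  shows "iterate s (t + 1) i = s (iterate s t i)"
proof (cases "t \<ge> 0")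
  case True
  then have "nat (t + 1) = Suc (nat t)" by simp
  with True show ?thesis by (simp add: iterate_def)
next
  case False
  then have "nat (- t) = Suc (nat (- (t + 1)))" by simp
  then have "s (iterate s t i) = (inv s ^^ nat (- (t + 1))) i"
    using False bij_is_surj[OF assms] by (simp add: iterate_def surj_f_inv_f)
  also have "\<dots> = iterate s (t + 1) i"
    using False by (cases "t = - 1") (auto simp: iterate_def)
  finally show ?thesis by simp
qed

lemma iterate_image:
  assumes "bij s"
  shows "iterate s t (s i) = iterate s (t + 1) i"
proof (cases "t \<ge> 0")
  case True
  then have "nat (t + 1) = Suc (nat t)" by simp
  with True show ?thesis by (simp add: iterate_def funpow_swap1)
next
  case False
  then have e: "nat (- t) = Suc (nat (- (t + 1)))" by simp
  then have "iterate s t (s i) = (inv s ^^ nat (- (t + 1))) i"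
    using False bij_is_inj[OF assms] by (simp add: iterate_def e funpow_swap1)
  also have "\<dots> = iterate s (t + 1) i"
    using False by (cases "t = - 1") (auto simp: iterate_def)
  finally show ?thesis .
qed

lemma iterate_mem:
  assumes "s permutes A"
  shows "iterate s t i \<in> A \<longleftrightarrow> i \<in> A"
proof -
  have "(r ^^ k) i \<in> A \<longleftrightarrow> i \<in> A" if "r permutes A" for r and k :: nat
    by (induction k) (auto simp: permutes_in_image[OF that])
  then show ?thesis
    using assms permutes_inv[OF assms] by (simp add: iterate_def)
qed

lemma itinerary_0 [simp]: "itinerary v s i 0 = (v i, i < s i)"
  by (simp add: itinerary_def iterate_def)

lemma itinerary_image:
  assumes "bij s"
  shows "itinerary v s (s i) = shift 1 (itinerary v s i)"
  by (simp add: itinerary_def shift_def iterate_image[OF assms])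

lemma itinerary_funpow:
  assumes "bij s"
  shows "itinerary v s ((s ^^ k) i) = shift (int k) (itinerary v s i)"
  by (induction k) (auto simp: itinerary_image[OF assms])

lemma itinerary_nat: "itinerary v s i (int t) = (v ((s ^^ t) i), (s ^^ t) i < (s ^^ Suc t) i)"
  by (simp add: itinerary_def)

lemma itinerary_unique:
  assumes s: "s permutes A" and step: "\<And>i. i \<in> A \<Longrightarrow> W (s i) = shift 1 (W i)"
    and head: "\<And>i. i \<in> A \<Longrightarrow> W i 0 = (v i, i < s i)" and "i \<in> A"
  shows "W i = itinerary v s i"
proof -
  have bij: "bij s" using s by (rule permutes_bij)
  have walk: "W i t = W (iterate s t i) 0" if "i \<in> A" for i t
    using that
  proof (induction t arbitrary: i rule: int_induct[of _ 0])
    case base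
    then show ?case by (simp add: iterate_def)
  next
    case (step1 t)
    have "W i (t + 1) = W (s i) t"
      using step[OF step1.prems] by (simp add: shift_apply)
    also have "\<dots> = W (iterate s t (s i)) 0"
      using step1 s by (simp add: permutes_in_image)
    finally show ?case by (simp add: iterate_image[OF bij])
  next
    case (step2 t)
    obtain i' where i': "i = s i'" using bij_is_surj[OF bij] by blast
    then have mem: "i' \<in> A" using step2.prems s by (simp add: permutes_in_image)
    have "W i (t - 1) = W i' t"
      using step[OF mem] by (simp add: i' shift_apply)
    also have "\<dots> = W (iterate s t i') 0"
      using step2 mem by blast
    finally show ?case
      using iterate_image[OF bij, of "t - 1" i'] by (simp add: i')
  qed
  show ?thesis
    using walk[OF \<open>i \<in> A\<close>] head iterate_mem[OF s] \<open>i \<in> A\<close> by (auto simp: itinerary_def)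
qed

lemma add_le_funpow:
  assumes "\<And>k. (f ^^ k) i < (f ^^ Suc k) (i :: nat)"
  shows "i + k \<le> (f ^^ k) i"
proof (induction k)
  case (Suc k)
  then show ?case using assms[of k] by simp
qed simp

text \<open>Let \<open>v\<close> be a weakly decreasing index sequence. It may be used with \<open>\<sigma>\<close> in the fundamental
quasisymmetric function of \<open>DEX \<sigma>\<close> if it decreases strictly at the positions of \<open>DEX \<sigma>\<close>. The last
two assumptions say this without reference to adjacent positions: on a block of constancy of \<open>v\<close>
the barred word of \<open>\<sigma>\<close> increases, so the excedances come first, and \<open>\<sigma>\<close> increases on the
excedances as well as on the other elements.\<close>

locale labelled_permutation =
  fixes n :: nat and v :: "nat \<Rightarrow> nat" and \<sigma> :: "nat \<Rightarrow> nat"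
  assumes perm: "\<sigma> permutes {1..n}"
    and v_decreasing: "\<lbrakk>1 \<le> i; i \<le> i'; i' \<le> n\<rbrakk> \<Longrightarrow> v i' \<le> v i"
    and exc_first: "\<lbrakk>1 \<le> i; i < i'; i' \<le> n; v i = v i'; i' < \<sigma> i'\<rbrakk> \<Longrightarrow> i < \<sigma> i"
    and increasing: "\<lbrakk>1 \<le> i; i < i'; i' \<le> n; v i = v i'; i < \<sigma> i \<longleftrightarrow> i' < \<sigma> i'\<rbrakk> \<Longrightarrow> \<sigma> i < \<sigma> i'"
begin

abbreviation word_at :: "nat \<Rightarrow> word" where
  "word_at \<equiv> itinerary v \<sigma>"

definition words :: "word multiset" where
  "words = image_mset word_at (mset_set {1..n})"

lemma bij: "bij \<sigma>"
  using perm by (rule permutes_bij)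

lemma mem: "\<sigma> i \<in> {1..n} \<longleftrightarrow> i \<in> {1..n}"
  using perm by (rule permutes_in_image)

lemma funpow_mem: "(\<sigma> ^^ k) i \<in> {1..n} \<longleftrightarrow> i \<in> {1..n}"
  using iterate_mem[OF perm, of "int k" i] by simp

lemma periodic_word: "periodic (word_at i)"
proof -
  have "permutation \<sigma>"
    unfolding permutation_permutes using perm finite_atLeastAtMost by blast
  then obtain k where "(\<sigma> ^^ k) i = i" "0 < k"
    using permutation_self[of \<sigma> i] by metis
  then show ?thesis
    unfolding periodic_def using itinerary_funpow[OF bij, of v k i]
    by (intro exI[of _ "int k"]) simp
qed

text \<open>Two elements that carry the same letter are kept in order by \<open>\<sigma>\<close>, so as long as two itineraries
agree, the elements they visit stay in order. Consequences are that \<open>1, ..., n\<close> lists the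
itineraries in sorted order and that no cycle has an itinerary of smaller period.\<close>

lemma same_letters_keep_order:
  assumes "i \<in> {1..n}" "i' \<in> {1..n}" "i < i'"
    and "\<And>s. s < t \<Longrightarrow> word_at i (int s) = word_at i' (int s)"
  shows "(\<sigma> ^^ t) i < (\<sigma> ^^ t) i'"
  using assms(4)
proof (induction t)
  case (Suc t)
  then have "(\<sigma> ^^ t) i < (\<sigma> ^^ t) i'" by simp
  moreover have "(\<sigma> ^^ t) i \<in> {1..n}" "(\<sigma> ^^ t) i' \<in> {1..n}"
    using assms(1,2) funpow_mem by auto
  moreover have "word_at i (int t) = word_at i' (int t)"
    using Suc.prems by simp
  ultimately show ?case
    using increasing[of "(\<sigma> ^^ t) i" "(\<sigma> ^^ t) i'"] by (simp add: itinerary_nat)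
qed (use assms(3) in simp)

lemma sorted_words:
  assumes "1 \<le> i" "i < i'" "i' \<le> n"
  shows "word_at i = word_at i' \<or> precedes (word_at i) (word_at i')"
proof (cases "word_at i = word_at i'")
  case False
  then obtain t where t: "\<And>s. s < t \<Longrightarrow> word_at i (int s) = word_at i' (int s)"
      "word_at i (int t) \<noteq> word_at i' (int t)"
    using first_difference[OF periodic_word periodic_word] by metis
  have mems: "i \<in> {1..n}" "i' \<in> {1..n}" using assms by auto
  let ?x = "(\<sigma> ^^ t) i" and ?y = "(\<sigma> ^^ t) i'"
  have "?x < ?y"
    using same_letters_keep_order[OF mems assms(2) t(1)] .
  moreover have "?x \<in> {1..n}" "?y \<in> {1..n}"
    using mems funpow_mem by auto
  ultimately have "letter_before (word_at i (int t)) (word_at i' (int t))"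
    using t(2) v_decreasing[of ?x ?y] exc_first[of ?x ?y]
    by (auto simp: letter_before_def itinerary_nat)
  then show ?thesis
    using t(1) by (auto simp: precedes_def)
qed simp

lemma sorted_enumeration_words: "sorted_enumeration n word_at words"
  unfolding sorted_enumeration_def words_def
  using sorted_words periodic_word by auto

lemma admissible_word:
  assumes "i \<in> {1..n}"
  shows "admissible (word_at i)"
proof -
  have "if snd (word_at i t) then fst (word_at i (t + 1)) \<le> fst (word_at i t)
      else fst (word_at i t) \<le> fst (word_at i (t + 1))" for t
  proof -
    let ?x = "iterate \<sigma> t i"
    have "?x \<in> {1..n}" "\<sigma> ?x \<in> {1..n}"
      using assms iterate_mem[OF perm] mem by auto
    then show ?thesis
      using v_decreasing[of ?x "\<sigma> ?x"] v_decreasing[of "\<sigma> ?x" ?x]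
      by (auto simp: itinerary_def iterate_step[OF bij])
  qed
  moreover have "\<exists>t. \<not> snd (word_at i t)"
  proof (rule ccontr)
    assume "\<not> ?thesis"
    then have "(\<sigma> ^^ k) i < (\<sigma> ^^ Suc k) i" for k
      by (metis itinerary_nat snd_conv)
    from add_le_funpow[of \<sigma>, OF this, of "Suc n"] funpow_mem[of "Suc n" i] assms
    show False by simp
  qed
  ultimately show ?thesis
    unfolding admissible_def by blast
qed

text \<open>If \<open>\<sigma> ^^ d\<close> moved \<open>i\<close> to a different element with the same itinerary, it would move that element
again in the same direction, and so on for ever, which is impossible within \<open>{1..n}\<close>.\<close>

lemma primitive_word:
  assumes "i \<in> {1..n}"
  shows "shift (int d) (word_at i) = word_at i \<longleftrightarrow> (\<sigma> ^^ d) i = i"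
proof
  define f where "f = \<sigma> ^^ d"
  assume eq: "shift (int d) (word_at i) = word_at i"
  have words: "word_at ((f ^^ k) i) = word_at i" for k
  proof (induction k)
    case (Suc k)
    have "word_at ((f ^^ Suc k) i) = shift (int d) (word_at ((f ^^ k) i))"
      by (simp add: f_def itinerary_funpow[OF bij])
    then show ?case using Suc eq by simp
  qed simp
  have range: "(f ^^ k) i \<in> {1..n}" for k
    using assms funpow_mem[of "d * k" i] by (simp add: f_def funpow_mult mult.commute)
  have mono: "f x < f y" if "x \<in> {1..n}" "y \<in> {1..n}" "x < y" "word_at x = word_at y" for x y
    unfolding f_def using same_letters_keep_order[OF that(1-3)] that(4) by simp
  show "(\<sigma> ^^ d) i = i"
  proof (cases i "f i" rule: linorder_cases)
    case less
    have "(f ^^ k) i < (f ^^ Suc k) i" for k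
    proof (induction k)
      case (Suc k)
      then show ?case
        using mono[OF range range, of k "Suc k"] words[of k] words[of "Suc k"] by simp
    qed (use less in simp)
    from add_le_funpow[of f, OF this, of "Suc n"] range[of "Suc n"] show ?thesis by simp
  next
    case greater
    have dec: "(f ^^ Suc k) i < (f ^^ k) i" for k
    proof (induction k)
      case (Suc k)
      then show ?case
        using mono[OF range range, of "Suc k" k] words[of k] words[of "Suc k"] by simp
    qed (use greater in simp)
    have "(f ^^ k) i + k \<le> i" for k
    proof (induction k)
      case (Suc k)
      then show ?case using dec[of k] by simp
    qed simp
    from this[of "Suc i"] show ?thesis by simp
  qed (simp add: f_def)
qed (metis itinerary_funpow[OF bij])

lemma shift_words: "image_mset (shift 1) words = words"
proof -
  have "image_mset (shift 1) words = image_mset (\<lambda>i. word_at (\<sigma> i)) (mset_set {1..n})"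
    by (simp add: words_def image_mset.compositionality o_def itinerary_image[OF bij])
  also have "\<dots> = image_mset word_at (image_mset \<sigma> (mset_set {1..n}))"
    by (simp add: image_mset.compositionality o_def)
  also have "image_mset \<sigma> (mset_set {1..n}) = mset_set {1..n}"
    using image_mset_mset_set[of \<sigma> "{1..n}"] permutes_inj_on[OF perm] permutes_image[OF perm] by simp
  finally show ?thesis
    by (simp add: words_def)
qed

text \<open>The elements with images up to \<open>\<sigma> i\<close> can be recognised from their itineraries, since the order of
the images is the order of the shifted itineraries, with ties broken by the elements themselves.\<close>

lemma permutation_from_words:
  assumes "i \<in> {1..n}"
  shows "\<sigma> i = card {i' \<in> {1..n}. precedes (shift 1 (word_at i')) (shift 1 (word_at i)) \<or>
    word_at i' = word_at i \<and> i' \<le> i}"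
proof -
  have "\<sigma> i' \<le> \<sigma> i \<longleftrightarrow> precedes (shift 1 (word_at i')) (shift 1 (word_at i)) \<or>
      word_at i' = word_at i \<and> i' \<le> i" if i': "i' \<in> {1..n}" for i'
  proof (cases "word_at i' = word_at i")
    case True
    then have "i' \<le> i \<longleftrightarrow> \<sigma> i' \<le> \<sigma> i"
      using same_letters_keep_order[OF i' assms, of 1] same_letters_keep_order[OF assms i', of 1]
      by (cases i i' rule: linorder_cases) auto
    then show ?thesis using True by simp
  next
    case False
    then have ne: "word_at (\<sigma> i') \<noteq> word_at (\<sigma> i)"
      by (simp add: itinerary_image[OF bij])
    have "\<sigma> i' \<in> {1..n}" "\<sigma> i \<in> {1..n}" using assms i' mem by auto
    then have "\<sigma> i' \<le> \<sigma> i \<longleftrightarrow> precedes (word_at (\<sigma> i')) (word_at (\<sigma> i))"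
      using sorted_words[of "\<sigma> i'" "\<sigma> i"] sorted_words[of "\<sigma> i" "\<sigma> i'"] ne precedes_asym
      by (cases "\<sigma> i" "\<sigma> i'" rule: linorder_cases) auto
    then show ?thesis using False by (simp add: itinerary_image[OF bij])
  qed
  then have "{i' \<in> {1..n}. precedes (shift 1 (word_at i')) (shift 1 (word_at i)) \<or>
      word_at i' = word_at i \<and> i' \<le> i} = {i' \<in> {1..n}. \<sigma> i' \<le> \<sigma> i}"
    by blast
  moreover have "\<sigma> ` {i' \<in> {1..n}. \<sigma> i' \<le> \<sigma> i} = {1..\<sigma> i}"
  proof -
    have "\<sigma> i \<le> n" using assms mem[of i] by simp
    moreover have "x \<in> \<sigma> ` {1..n}" if "x \<in> {1..n}" for x
      using that permutes_image[OF perm] by simp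
    ultimately show ?thesis using mem by fastforce
  qed
  moreover have "inj_on \<sigma> {i' \<in> {1..n}. \<sigma> i' \<le> \<sigma> i}"
    using permutes_inj_on[OF perm] .
  ultimately show ?thesis
    using card_image by fastforce
qed

end

lemma labelled_permutation_unique:
  assumes "labelled_permutation n v s" "labelled_permutation n v s'"
    and "labelled_permutation.words n v s = labelled_permutation.words n v s'"
  shows "s = s'"
proof
  interpret a: labelled_permutation n v s by fact
  interpret b: labelled_permutation n v s' by fact
  fix i
  have "a.word_at i = b.word_at i" if "i \<in> {1..n}" for i
    using enumeration_unique[of n a.word_at a.words b.word_at] that assms(3)
      a.sorted_enumeration_words b.sorted_enumeration_words by simp
  then show "s i = s' i"
    using a.permutation_from_words b.permutation_from_words a.perm b.perm
    by (cases "i \<in> {1..n}") (auto simp: permutes_not_in cong: conj_cong)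
qed

section \<open>Cycle types and excedances\<close>

lemma card_orbit_eq_least:
  assumes "permutation s"
  shows "card (orbit s i) = (LEAST d. 0 < d \<and> (s ^^ d) i = i)"
proof -
  define d where "d = (LEAST d. 0 < d \<and> (s ^^ d) i = i)"
  have ex: "\<exists>d. 0 < d \<and> (s ^^ d) i = i"
    using permutation_self[OF assms, of i] by metis
  have d: "0 < d" "(s ^^ d) i = i"
    using LeastI_ex[OF ex] by (auto simp: d_def)
  have least: "(s ^^ m) i \<noteq> i" if "0 < m" "m < d" for m
    using not_less_Least[of m "\<lambda>d. 0 < d \<and> (s ^^ d) i = i"] that by (auto simp: d_def)
  have "orbit s i = (\<lambda>m. (s ^^ m) i) ` {0..<d}"
    using orbit_altdef_bounded[OF d(2,1)] by auto
  moreover have "inj_on (\<lambda>m. (s ^^ m) i) {0..<d}"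
    using d(2) least by (intro inj_on_funpow_least) auto
  ultimately show ?thesis
    by (simp add: card_image flip: d_def)
qed

text \<open>Each cycle of length \<open>p\<close> has \<open>p\<close> elements.\<close>

lemma card_cycles_of_length:
  assumes "s permutes {1..n}"
  shows "card {i \<in> {1..n}. card (orbit s i) = p} = p * count (cycle_type n s) p"
proof -
  define C where "C = {c \<in> orbit s ` {1..n}. card c = p}"
  have perm: "permutation s"
    using assms finite_atLeastAtMost unfolding permutation_permutes by blast
  have orbit_eq: "orbit s i = orbit s x" if "i \<in> orbit s x" for i x
    using cyclic_on_orbit'[OF perm, of x] that by (auto simp: cyclic_on_alldef)
  have self: "i \<in> orbit s i" for i
    using permutation_self_in_orbit[OF perm] .
  have "{i \<in> {1..n}. card (orbit s i) = p} = \<Union> C"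
  proof (intro equalityI subsetI)
    fix i assume "i \<in> \<Union> C"
    then obtain x where x: "x \<in> {1..n}" "i \<in> orbit s x" "card (orbit s x) = p"
      by (auto simp: C_def)
    then show "i \<in> {i \<in> {1..n}. card (orbit s i) = p}"
      using orbit_eq[of i x] permutes_orbit_subset[OF assms x(1)] by auto
  qed (use self in \<open>auto simp: C_def\<close>)
  moreover have "card (\<Union> C) = sum card C"
  proof (rule card_Union_disjoint)
    show "pairwise disjnt C"
      unfolding pairwise_def disjnt_def C_def using orbit_eq by blast
    show "\<And>c. c \<in> C \<Longrightarrow> finite c"
      using finite_orbit[OF self] by (auto simp: C_def)
  qed
  moreover have "sum card C = p * card C"
    by (simp add: C_def)
  moreover have "count (cycle_type n s) p = card C"
  proof -
    have "C = {c \<in> orbit s ` {1..n}. p = card c}" by (auto simp: C_def)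
    then show ?thesis
      by (simp add: cycle_type_def count_image_mset')
  qed
  ultimately show ?thesis by simp
qed

lemma cycle_type_eq_iff:
  assumes "s permutes {1..n}" "0 \<notin># lam"
  shows "cycle_type n s = lam \<longleftrightarrow> (\<forall>p. card {i \<in> {1..n}. card (orbit s i) = p} = p * count lam p)"
proof -
  have perm: "permutation s"
    using assms finite_atLeastAtMost unfolding permutation_permutes by blast
  have "finite (orbit s i)" for i
    using finite_orbit[OF permutation_self_in_orbit[OF perm]] .
  then have "0 \<notin># cycle_type n s"
    using orbit_nonempty[of s] by (auto simp: cycle_type_def)
  then have "cycle_type n s = lam \<longleftrightarrow> (\<forall>p. p * count (cycle_type n s) p = p * count lam p)"
    using assms(2) by (auto simp: multiset_eq_iff not_in_iff)
  then show ?thesis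
    unfolding card_cycles_of_length[OF assms(1)] .
qed

lemma exc_eq_card:
  assumes "s permutes {1..n}"
  shows "exc n s = card {i \<in> {1..n}. i < s i}"
proof -
  have "EXC n s = {i \<in> {1..n}. i < s i}"
  proof -
    have "i \<le> n - 1" if "1 \<le> i" "i \<le> n" "i < s i" for i
      using permutes_in_image[OF assms, of i] that by simp
    then show ?thesis by (auto simp: EXC_def)
  qed
  then show ?thesis by (simp add: exc_def)
qed

lemma (in labelled_permutation) words_in_ornaments_iff:
  assumes "0 \<notin># lam"
  shows "words \<in> ornaments lam j m \<longleftrightarrow>
    image_mset v (mset_set {1..n}) = m \<and> exc n \<sigma> = j \<and> cycle_type n \<sigma> = lam"
proof -
  have perm': "permutation \<sigma>"
    using perm finite_atLeastAtMost unfolding permutation_permutes by blast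
  have "\<forall>u\<in>#words. admissible u"
    using admissible_word by (auto simp: words_def)
  moreover have "image_mset (\<lambda>u. fst (u 0)) words = image_mset v (mset_set {1..n})"
    by (simp add: words_def image_mset.compositionality o_def)
  moreover have "size {#u \<in># words. snd (u 0)#} = exc n \<sigma>"
    unfolding words_def by (subst size_filter_image) (auto simp: exc_eq_card[OF perm])
  moreover have "size {#u \<in># words. period u = p#} = card {i \<in> {1..n}. card (orbit \<sigma> i) = p}" for p
  proof -
    have "period (word_at i) = card (orbit \<sigma> i)" if "i \<in> {1..n}" for i
      unfolding period_def card_orbit_eq_least[OF perm'] primitive_word[OF that] ..
    then show ?thesis
      unfolding words_def by (subst size_filter_image) (auto cong: conj_cong)
  qed
  ultimately show ?thesis
    using shift_words cycle_type_eq_iff[OF perm assms] by (auto simp: ornaments_def)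
qed

section \<open>From ornaments to permutations\<close>

definition nth_largest :: "nat multiset \<Rightarrow> nat \<Rightarrow> nat" where
  "nth_largest m i = rev (sorted_list_of_multiset m) ! (i - 1)"

lemma nth_largest_decreasing:
  assumes "1 \<le> i" "i \<le> i'" "i' \<le> size m"
  shows "nth_largest m i' \<le> nth_largest m i"
proof -
  have "length (sorted_list_of_multiset m) = size m"
    by (metis mset_sorted_list_of_multiset size_mset)
  then show ?thesis
    using assms by (auto simp: nth_largest_def rev_nth intro!: sorted_nth_mono)
qed

lemma map_nth_largest:
  "map (nth_largest m) [1..<Suc (size m)] = rev (sorted_list_of_multiset m)"
proof -
  have "length (sorted_list_of_multiset m) = size m"
    by (metis mset_sorted_list_of_multiset size_mset)
  then show ?thesis
    by (intro nth_equalityI) (auto simp: nth_largest_def simp del: upt_Suc)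
qed

lemma image_nth_largest: "image_mset (nth_largest m) (mset_set {1..size m}) = m"
  unfolding mset_set_image_upt map_nth_largest by simp

lemma decreasing_list_unique:
  fixes l :: "nat list"
  assumes "\<forall>j\<in>{1..length l - 1}. l ! j \<le> l ! (j - 1)" "mset l = m"
  shows "l = rev (sorted_list_of_multiset m)"
proof -
  have trans: "transp (\<lambda>x y::nat. y \<le> x)" by (auto simp: transp_def)
  have "\<forall>i. Suc i < length l \<longrightarrow> l ! Suc i \<le> l ! i"
    using assms(1) by force
  then have "sorted_wrt (\<lambda>x y. y \<le> x) l"
    by (simp add: sorted_wrt_iff_nth_Suc_transp[OF trans])
  then have "sorted (rev l)" by (simp add: sorted_wrt_rev)
  then have "sorted_list_of_multiset m = rev l"
    using sorted_list_of_multiset_mset[of "rev l"] assms(2) by (simp add: sorted_sort_id)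
  then show ?thesis by simp
qed

lemma nth_largest_unique:
  assumes "image_mset h (mset_set {1..n}) = m"
    and "\<And>i i'. 1 \<le> i \<Longrightarrow> i < i' \<Longrightarrow> i' \<le> n \<Longrightarrow> h i' \<le> h i" and "i \<in> {1..n}"
  shows "h i = nth_largest m i"
proof -
  have "map h [1..<Suc n] = rev (sorted_list_of_multiset m)"
  proof (rule decreasing_list_unique)
    show "\<forall>j\<in>{1..length (map h [1..<Suc n]) - 1}. map h [1..<Suc n] ! j \<le> map h [1..<Suc n] ! (j - 1)"
      using assms(2) by (auto simp del: upt_Suc)
    show "mset (map h [1..<Suc n]) = m"
      using assms(1) unfolding mset_set_image_upt .
  qed
  then have "nth_largest m i = map h [1..<Suc n] ! (i - 1)"
    by (simp add: nth_largest_def del: upt_Suc)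
  then show ?thesis
    using assms(3) by (auto simp del: upt_Suc)
qed

text \<open>Arrange the words of \<open>M\<close> in sorted order as \<open>U 1, ..., U n\<close>. The permutation sends the copies of a
word \<open>u\<close>, which occupy an interval of positions, to the copies of \<open>shift 1 u\<close>, which are equally
many and occupy another interval, in increasing order. The flag of \<open>U i\<close> at 0 then marks the
excedances, because \<open>u\<close> is barred at 0 if and only if it precedes \<open>shift 1 u\<close>.\<close>

lemma ornament_from_permutation:
  assumes M: "M \<in> ornaments lam j m" and lam: "0 \<notin># lam"
  shows "\<exists>s. labelled_permutation (size m) (nth_largest m) s \<and>
    labelled_permutation.words (size m) (nth_largest m) s = M"
proof -
  define n where "n = size m"
  have inv: "image_mset (shift 1) M = M" and adm: "\<And>u. u \<in># M \<Longrightarrow> admissible u"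
    and heads: "image_mset (\<lambda>u. fst (u 0)) M = m"
    using M by (auto simp: ornaments_def)
  have cyc: "periodic u" if "u \<in># M" for u
    using shift_invariant_periodic[OF inv that] .
  have n: "size M = n"
    using heads unfolding n_def by auto
  obtain U where U: "sorted_enumeration n U M"
    using enumeration_exists[of M] cyc n by auto
  have sorted: "U i = U i' \<or> precedes (U i) (U i')" if "1 \<le> i" "i < i'" "i' \<le> n" for i i'
    using U that unfolding sorted_enumeration_def by blast
  have mem: "U i \<in># M" if "i \<in> {1..n}" for i
    using enumeration_mem[OF U that] by simp
  \<comment> \<open>The \<open>c\<close>-th copy of a word is sent to the \<open>c\<close>-th copy of its shift.\<close>
  define s where "s i = (if i \<in> {1..n} then i - rank M (U i) + rank M (shift 1 (U i)) else i)" for i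
  have count: "count M (shift 1 u) = count M u" for u
    using shift_invariant_count[OF inv] .
  have bounds: "rank M (shift 1 (U i)) < s i" "s i \<le> rank M (shift 1 (U i)) + count M (shift 1 (U i))"
    if "i \<in> {1..n}" for i
    using rank_bounds[OF U that] that by (auto simp: s_def count)
  have range: "s i \<in> {1..n}" if "i \<in> {1..n}" for i
    using bounds[OF that] rank_count_le_size[of M "shift 1 (U i)"] n by auto
  have step: "U (s i) = shift 1 (U i)" if "i \<in> {1..n}" for i
    using enumeration_eqI[OF U range[OF that] _ bounds[OF that]] cyc mem[OF that] by simp
  have "inj_on s {1..n}"
  proof (rule inj_onI)
    fix i i' assume i: "i \<in> {1..n}" "i' \<in> {1..n}" "s i = s i'"
    then have "U i = U i'" using step by (metis shift_eq_iff)
    then show "i = i'"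
      using i rank_bounds(1)[OF U i(1)] rank_bounds(1)[OF U i(2)] by (simp add: s_def)
  qed
  moreover have "s ` {1..n} \<subseteq> {1..n}"
    using range by blast
  ultimately have "bij_betw s {1..n} {1..n}"
    by (simp add: bij_betw_def endo_inj_surj)
  then have perm: "s permutes {1..n}"
    by (rule bij_imp_permutes) (unfold s_def, rule if_not_P)
  have exc: "i < s i \<longleftrightarrow> snd (U i 0)" if i: "i \<in> {1..n}" for i
  proof -
    have peri: "periodic (U i)" "periodic (shift 1 (U i))" using cyc mem[OF i] by simp_all
    have pos: "count M (U i) > 0" using mem[OF i] by simp
    have "i < s i \<longleftrightarrow> rank M (U i) < rank M (shift 1 (U i))"
      using rank_bounds(1)[OF U i] i by (auto simp: s_def)
    also have "\<dots> \<longleftrightarrow> precedes (U i) (shift 1 (U i))"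
    proof (cases "precedes (U i) (shift 1 (U i))")
      case True
      then show ?thesis using rank_less[OF True, of M] pos by linarith
    next
      case False
      then have "U i = shift 1 (U i) \<or> precedes (shift 1 (U i)) (U i)"
        using precedes_total[OF peri] by blast
      then have "rank M (shift 1 (U i)) \<le> rank M (U i)"
        using rank_less[of "shift 1 (U i)" "U i" M] by auto
      with False show ?thesis by simp
    qed
    also have "\<dots> \<longleftrightarrow> snd (U i 0)"
      using precedes_next_iff[OF peri(1)] adm[OF mem[OF i]] by simp
    finally show ?thesis .
  qed
  have head: "fst (U i 0) = nth_largest m i" if "i \<in> {1..n}" for i
  proof (rule nth_largest_unique[where h = "\<lambda>i. fst (U i 0)" and n = n])
    show "image_mset (\<lambda>i. fst (U i 0)) (mset_set {1..n}) = m"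
      using U heads by (auto simp: sorted_enumeration_def image_mset.compositionality o_def)
    show "fst (U i' 0) \<le> fst (U i 0)" if "1 \<le> i" "i < i'" "i' \<le> n" for i i'
      using sorted[OF that] precedes_head[of "U i" "U i'"] by (auto simp: letter_before_def)
  qed (rule that)
  have lp: "labelled_permutation n (nth_largest m) s"
  proof
    show "s permutes {1..n}" by (rule perm)
    show "nth_largest m i' \<le> nth_largest m i" if "1 \<le> i" "i \<le> i'" "i' \<le> n" for i i'
      using nth_largest_decreasing that by (simp add: n_def)
  next
    fix i i' assume i: "1 \<le> i" "i < i'" "i' \<le> n" "nth_largest m i = nth_largest m i'"
    then have mems: "i \<in> {1..n}" "i' \<in> {1..n}" by auto
    have same: "fst (U i 0) = fst (U i' 0)" using head mems i by simp
    show "i < s i" if "i' < s i'"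
      using that sorted[OF i(1-3)] precedes_head[of "U i" "U i'"] same
      unfolding exc[OF mems(1)] exc[OF mems(2)] by (auto simp: letter_before_def)
    show "s i < s i'" if "i < s i \<longleftrightarrow> i' < s i'"
    proof (cases "U i = U i'")
      case True
      then show ?thesis
        using mems i rank_bounds(1)[OF U mems(1)] by (simp add: s_def)
    next
      case False
      have "U i 0 = U i' 0"
        using that same unfolding exc[OF mems(1)] exc[OF mems(2)] by (simp add: prod_eq_iff)
      then have "precedes (shift 1 (U i)) (shift 1 (U i'))"
        using False sorted[OF i(1-3)] precedes_tail by blast
      then show ?thesis
        using rank_less[of "shift 1 (U i)" "shift 1 (U i')" M] bounds(2)[OF mems(1)]
          bounds(1)[OF mems(2)] by simp
    qed
  qed
  have "U i = itinerary (nth_largest m) s i" if "i \<in> {1..n}" for i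
  proof (rule itinerary_unique[where W = U, OF perm step _ that])
    show "U i 0 = (nth_largest m i, i < s i)" if "i \<in> {1..n}" for i
      using head[OF that] exc[OF that] by (simp add: prod_eq_iff)
  qed
  then have "image_mset (itinerary (nth_largest m) s) (mset_set {1..n}) = image_mset U (mset_set {1..n})"
    by (intro image_mset_cong) simp
  then have "labelled_permutation.words n (nth_largest m) s = M"
    using U by (simp add: labelled_permutation.words_def[OF lp] sorted_enumeration_def)
  with lp show ?thesis unfolding n_def by blast
qed

text \<open>The words of a labelled permutation form an ornament, and they determine the permutation, so the
two kinds of objects are equinumerous.\<close>

lemma card_labelled_permutations:
  assumes lam: "0 \<notin># lam"
  shows "card {s. labelled_permutation (size m) (nth_largest m) s \<and>
    exc (size m) s = j \<and> cycle_type (size m) s = lam} = card (ornaments lam j m)"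
    (is "card ?P = _")
proof (rule bij_betw_same_card)
  let ?w = "labelled_permutation.words (size m) (nth_largest m)"
  have iff: "?w s \<in> ornaments lam j m \<longleftrightarrow> exc (size m) s = j \<and> cycle_type (size m) s = lam"
    if "labelled_permutation (size m) (nth_largest m) s" for s
    using labelled_permutation.words_in_ornaments_iff[OF that lam] image_nth_largest by simp
  show "bij_betw ?w ?P (ornaments lam j m)"
    unfolding bij_betw_def
  proof
    show "inj_on ?w ?P"
      by (rule inj_onI) (use labelled_permutation_unique in blast)
    show "?w ` ?P = ornaments lam j m"
      using iff ornament_from_permutation[OF _ lam] by (auto simp: image_iff) metis
  qed
qed

section \<open>The coefficients count ornaments\<close>

lemma barred_word_alt:
  assumes "s permutes {1..n}" "i \<in> {1..n}"
  shows "barred_word n s i = (if i < s i then Barred (s i) else Plain (s i))"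
proof -
  have "s i \<le> n" using permutes_in_image[OF assms(1), of i] assms(2) by simp
  then have "i \<in> EXC n s \<longleftrightarrow> i < s i" using assms(2) by (auto simp: EXC_def)
  then show ?thesis by (simp add: barred_word_def)
qed

lemma labelled_permutation_iff_DEX:
  assumes "s permutes {1..n}"
    and decr: "\<And>i i'. 1 \<le> i \<Longrightarrow> i \<le> i' \<Longrightarrow> i' \<le> n \<Longrightarrow> v i' \<le> v i"
  shows "labelled_permutation n v s \<longleftrightarrow> (\<forall>i\<in>DEX n s. v (i + 1) < v i)"
proof
  assume "labelled_permutation n v s"
  then interpret labelled_permutation n v s .
  show "\<forall>i\<in>DEX n s. v (i + 1) < v i"
  proof (rule ballI, rule ccontr)
    fix i assume i: "i \<in> DEX n s" and "\<not> v (i + 1) < v i"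
    then have mems: "i \<in> {1..n}" "i + 1 \<in> {1..n}" by (auto simp: DEX_def)
    with \<open>\<not> v (i + 1) < v i\<close> have "v i = v (i + 1)"
      using v_decreasing[of i "i + 1"] by simp
    moreover have "barred_word n s (i + 1) < barred_word n s i"
      using i by (simp add: DEX_def)
    ultimately show False
      using exc_first[of i "i + 1"] increasing[of i "i + 1"] mems
      unfolding barred_word_alt[OF assms(1) mems(1)] barred_word_alt[OF assms(1) mems(2)]
      by (auto split: if_splits)
  qed
next
  assume D: "\<forall>i\<in>DEX n s. v (i + 1) < v i"
  have ascending: "barred_word n s i \<le> barred_word n s (i + d)"
    if "1 \<le> i" "i + d \<le> n" "v i = v (i + d)" for i d
    using that(2,3)
  proof (induction d)
    case (Suc d)
    then have "v (i + d) \<le> v i" "v (i + Suc d) \<le> v (i + d)"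
      using decr[of i "i + d"] decr[of "i + d" "i + Suc d"] that(1) by simp_all
    with Suc.prems have eq: "v i = v (i + d)" "v (i + d) = v (i + d + 1)" by simp_all
    then have "i + d \<notin> DEX n s" using D by force
    then have "barred_word n s (i + d) \<le> barred_word n s (i + d + 1)"
      using that(1) Suc.prems by (auto simp: DEX_def)
    then show ?case
      using Suc eq(1) by (auto intro: order_trans)
  qed simp
  show "labelled_permutation n v s"
  proof
    fix i i' assume i: "1 \<le> i" "i < i'" "i' \<le> n" "v i = v i'"
    then have mems: "i \<in> {1..n}" "i' \<in> {1..n}" by auto
    have le: "barred_word n s i \<le> barred_word n s i'"
      using ascending[of i "i' - i"] i by simp
    have ne: "s i \<noteq> s i'"
      using i permutes_inj[OF assms(1)] by (auto dest: injD)
    show "i < s i" if "i' < s i'"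
      using le that unfolding barred_word_alt[OF assms(1) mems(1)] barred_word_alt[OF assms(1) mems(2)]
      by (auto simp: less_eq_letter_def split: if_splits)
    show "s i < s i'" if "i < s i \<longleftrightarrow> i' < s i'"
      using le that ne unfolding barred_word_alt[OF assms(1) mems(1)] barred_word_alt[OF assms(1) mems(2)]
      by (auto simp: less_eq_letter_def split: if_splits)
  qed (use assms in auto)
qed

lemma Collect_at_most_one:
  assumes "\<forall>x. P x \<longrightarrow> x = a"
  shows "{x. P x} = (if P a then {a} else {})"
proof (cases "P a")
  case True
  then have "{x. P x} = {a}" using assms by blast
  with True show ?thesis by simp
next
  case False
  then have "{x. P x} = {}" using assms by blast
  with False show ?thesis by simp
qed

text \<open>A decreasing sequence is determined by its multiset of entries, so each permutation contributes at
most one to a given coefficient.\<close>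

lemma fundamental_qsym_DEX:
  assumes "s permutes {1..size m}" "set_mset m \<subseteq> {1..}"
  shows "fundamental_qsym (DEX (size m) s) (size m) m =
    (if labelled_permutation (size m) (nth_largest m) s then 1 else 0)"
proof -
  let ?n = "size m" and ?L = "rev (sorted_list_of_multiset m)"
  have len: "length ?L = ?n"
    by (metis mset_sorted_list_of_multiset size_mset length_rev)
  have at: "?L ! (i - 1) = nth_largest m i" "?L ! i = nth_largest m (i + 1)" for i
    by (simp_all add: nth_largest_def)
  have decr: "nth_largest m (i + 1) \<le> nth_largest m i" if "i \<in> {1..?n - 1}" for i
    using that by (intro nth_largest_decreasing) auto
  have unique: "l = ?L" if "l \<in> index_seqs (DEX ?n s) ?n" "mset l = m" for l
    using that by (intro decreasing_list_unique) (auto simp: index_seqs_def)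
  have iff: "?L \<in> index_seqs (DEX ?n s) ?n \<longleftrightarrow> labelled_permutation ?n (nth_largest m) s"
  proof -
    have "DEX ?n s \<subseteq> {1..?n - 1}" by (auto simp: DEX_def)
    then show ?thesis
      using assms(2) decr nth_largest_decreasing[of _ _ m]
      unfolding index_seqs_def mem_Collect_eq len at
      by (subst labelled_permutation_iff_DEX[OF assms(1)]) auto
  qed
  have "{l \<in> index_seqs (DEX ?n s) ?n. mset l = m} =
      (if ?L \<in> index_seqs (DEX ?n s) ?n \<and> mset ?L = m then {?L} else {})"
    by (rule Collect_at_most_one[of "\<lambda>l. l \<in> index_seqs (DEX ?n s) ?n \<and> mset l = m"])
      (use unique in blast)
  then show ?thesis
    by (simp add: fundamental_qsym_def iff)
qed

lemma fundamental_qsym_nonzero: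
  assumes "fundamental_qsym S n m \<noteq> 0"
  shows "size m = n \<and> set_mset m \<subseteq> {1..}"
proof -
  have "{l \<in> index_seqs S n. mset l = m} \<noteq> {}"
    using assms unfolding fundamental_qsym_def by (metis card.empty of_nat_0)
  then show ?thesis by (auto simp: index_seqs_def)
qed

lemma eulerian_qsym_nonzero:
  assumes "eulerian_qsym n lam j m \<noteq> 0"
  shows "size m = n \<and> set_mset m \<subseteq> {1..}"
proof -
  obtain S where "fundamental_qsym S n m \<noteq> 0"
    using assms unfolding eulerian_qsym_def by (metis (no_types, lifting) sum.neutral)
  then show ?thesis by (rule fundamental_qsym_nonzero)
qed

lemma eulerian_qsym_eq_card_ornaments:
  assumes "0 \<notin># lam" "size m = n" "set_mset m \<subseteq> {1..}"
  shows "eulerian_qsym n lam j m = int (card (ornaments lam j m))"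
proof -
  let ?A = "{s. s permutes {1..size m} \<and> exc (size m) s = j \<and> cycle_type (size m) s = lam}"
  have fin: "finite ?A"
    by (rule finite_subset[OF _ finite_permutations[of "{1..size m}"]]) auto
  have "eulerian_qsym n lam j m =
      (\<Sum>s\<in>?A. if labelled_permutation (size m) (nth_largest m) s then 1 else 0)"
    unfolding eulerian_qsym_def assms(2)[symmetric]
    by (rule sum.cong) (auto simp: fundamental_qsym_DEX[OF _ assms(3)])
  also have "\<dots> = int (card {s \<in> ?A. labelled_permutation (size m) (nth_largest m) s})"
    using fin by (simp add: sum.If_cases Int_def)
  also have "{s \<in> ?A. labelled_permutation (size m) (nth_largest m) s} =
      {s. labelled_permutation (size m) (nth_largest m) s \<and>
        exc (size m) s = j \<and> cycle_type (size m) s = lam}"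
    using labelled_permutation.perm by auto
  finally show ?thesis
    by (simp add: card_labelled_permutations[OF assms(1)])
qed

section \<open>Symmetry\<close>

lemma transposition_invariance:
  fixes f :: "nat multiset \<Rightarrow> 'b"
  assumes adj: "\<And>k m. f (image_mset (transpose k (Suc k)) m) = f m"
  shows "f (image_mset (transpose a b) m) = f m"
proof -
  have gen: "f (image_mset (transpose a (a + d)) m) = f m" for a d m
  proof (induction d arbitrary: m)
    case (Suc d)
    let ?t = "transpose (a + d) (Suc (a + d))"
    show ?case
    proof (cases "d = 0")
      case True
      then show ?thesis using adj by simp
    next
      case False
      then have "transpose a (a + Suc d) = ?t \<circ> transpose a (a + d) \<circ> ?t"
        by (auto simp: fun_eq_iff transpose_def)
      then have "image_mset (transpose a (a + Suc d)) m =
          image_mset ?t (image_mset (transpose a (a + d)) (image_mset ?t m))"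
        by (simp add: image_mset.compositionality o_assoc)
      then show ?thesis using adj Suc by metis
    qed
  qed simp
  show ?thesis
  proof (cases "a \<le> b")
    case True
    then show ?thesis using gen[of a "b - a" m] by simp
  next
    case False
    then show ?thesis using gen[of b "a - b" m] by (simp add: transpose_commute)
  qed
qed

text \<open>Only the values of \<open>w\<close> on the finitely many elements of \<open>m\<close> matter. Composing \<open>w\<close> with the
transposition of some \<open>x\<close> and \<open>w x\<close> reduces the number of elements that are moved, so a \<open>w\<close> of
infinite support causes no difficulty.\<close>

lemma injection_invariance:
  fixes f :: "nat multiset \<Rightarrow> 'b"
  assumes adj: "\<And>k m. f (image_mset (transpose k (Suc k)) m) = f m"
    and "inj w"
  shows "f (image_mset w m) = f m"
  using assms(2)
proof (induction "card {x \<in> set_mset m. w x \<noteq> x}" arbitrary: w m rule: less_induct)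
  case less
  show ?case
  proof (cases "\<forall>x\<in>#m. w x = x")
    case True
    then have "image_mset w m = image_mset id m" by (intro image_mset_cong) simp
    then show ?thesis by simp
  next
    case False
    then obtain x where x: "x \<in># m" "w x \<noteq> x" by blast
    define t where "t = transpose x (w x)"
    define m' where "m' = image_mset t m"
    have "m = image_mset t m'"
      by (simp add: m'_def t_def image_mset.compositionality o_def)
    have inj: "inj (w \<circ> t)"
      using less.prems by (simp add: t_def inj_compose)
    \<comment> \<open>This element was moved by \<open>w\<close>; afterwards it is fixed, or no longer present.\<close>
    define y where "y = (if w x \<in># m then w x else x)"
    have y: "y \<in># m" "w y \<noteq> y"
      using x less.prems by (auto simp: y_def dest: injD)
    have "{z \<in> set_mset m'. (w \<circ> t) z \<noteq> z} \<subseteq> {z \<in> set_mset m. w z \<noteq> z} - {y}"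
      using x less.prems
      by (auto simp: m'_def t_def y_def transpose_def split: if_splits)
    then have "card {z \<in> set_mset m'. (w \<circ> t) z \<noteq> z} \<le> card ({z \<in> set_mset m. w z \<noteq> z} - {y})"
      by (rule card_mono[rotated]) simp
    also have "\<dots> < card {z \<in> set_mset m. w z \<noteq> z}"
      using y by (intro card_Diff1_less) auto
    finally have "f (image_mset (w \<circ> t) m') = f m'"
      by (rule less.hyps) (rule inj)
    moreover have "image_mset (w \<circ> t) m' = image_mset w m"
      by (simp add: m'_def t_def image_mset.compositionality o_def)
    moreover have "f m' = f m"
      unfolding m'_def t_def by (rule transposition_invariance[of f, OF adj])
    ultimately show ?thesis by simp
  qed
qed

theorem theorem5p8:
  fixes n j :: nat and lam :: "nat multiset"
  assumes "n \<ge> 1"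
    and "is_partition lam n"
    and "j \<in> {0..n-1}"
  shows "symmetric_function (eulerian_qsym n lam j)"
  unfolding symmetric_function_def
proof (intro conjI allI impI)
  have lam: "0 \<notin># lam"
    using assms(2) by (simp add: is_partition_def)
  show "\<exists>d. \<forall>m. eulerian_qsym n lam j m \<noteq> 0 \<longrightarrow> size m \<le> d"
    using eulerian_qsym_nonzero[of n lam j] by (intro exI[of _ n]) simp
  show "set_mset m \<subseteq> {1..}" if "eulerian_qsym n lam j m \<noteq> 0" for m
    using eulerian_qsym_nonzero[OF that] by blast
  fix w m assume w: "w permutes ({1..} :: nat set)"
  have range: "set_mset (image_mset w m) \<subseteq> {1..} \<longleftrightarrow> set_mset m \<subseteq> {1..}"
    using permutes_in_image[OF w] by auto
  show "eulerian_qsym n lam j (image_mset w m) = eulerian_qsym n lam j m"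
  proof (cases "size m = n \<and> set_mset m \<subseteq> {1..}")
    case True
    have "card (ornaments lam j (image_mset w m)) = card (ornaments lam j m)"
      by (rule injection_invariance[of "\<lambda>m. card (ornaments lam j m)"])
        (rule card_ornaments_swap, rule permutes_inj[OF w])
    then show ?thesis
      using True range eulerian_qsym_eq_card_ornaments[OF lam] by simp
  next
    case False
    then show ?thesis
      using eulerian_qsym_nonzero[of n lam j] range by (metis size_image_mset)
  qed
qed

end
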